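(* Let $a(n)$, $n\ge 0$, be the cubic partition function, defined by $\sum_{n=0}^{\infty} a(n)q^n = \prod_{n=1}^{\infty} \frac{1}{(1-q^n)(1-q^{2n})}$. Then, as $n\to\infty$, $$\log a(n) = \pi \sqrt{n} - \frac{5}{4} \log n - \log 8 - \left(\frac{15}{8\pi} + \frac{\pi}{16}\right)\frac{1}{\sqrt{n}} + o\left(\frac{1}{\sqrt{n}}\right).$$
   Context: The cubic partition function $a(n)$ is the sequence of coefficients of the power series in $q$ given by $\sum_{n=0}^{\infty} a(n)q^n = \prod_{n=1}^{\infty} \frac{1}{(1-q^n)(1-q^{2n})}$ (as a formal power series, or for $|q|<1$). Its first values are $a(0)=1$, $a(1)=1$, $a(2)=3$, $a(3)=4$, $a(4)=9$. Here $\log$ is the natural logarithm. *)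

theory Defs
  imports
    "HOL-Analysis.Analysis"
    "HOL-Computational_Algebra.Formal_Power_Series"
    "HOL-Library.Landau_Symbols"
begin

(* The factor for the index n + 1: infinite products in the library start at 0. *)
definition cubic_partition_factor :: "nat \<Rightarrow> real fps" where
  "cubic_partition_factor n =
     1 / ((1 - fps_X ^ (n + 1)) * (1 - fps_X ^ (2 * (n + 1))))"

(* The infinite product is taken in the library's metric topology on formal power series;
   it converges by has_prod_cubic_partition_gf below. *)
definition cubic_partition_gf :: "real fps" where
  "cubic_partition_gf = (\<Prod>n. cubic_partition_factor n)"

definition cubic_partition :: "nat \<Rightarrow> real" where
  "cubic_partition n = fps_nth cubic_partition_gf n"

lemma has_prod_cubic_partition_gf: "cubic_partition_factor has_prod cubic_partition_gf"
proof -
  let ?f = cubic_partition_factor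
  define D :: "nat \<Rightarrow> real fps"
    where "D n = (1 - fps_X ^ (n + 1)) * (1 - fps_X ^ (2 * (n + 1)))" for n
  have D0: "fps_nth (D n) 0 = 1" for n
    by (simp add: D_def)
  have f_D: "?f n = inverse (D n)" for n
    using D0[of n] by (simp add: cubic_partition_factor_def D_def fps_divide_unit)
  have f0: "fps_nth (?f n) 0 = 1" for n
    by (simp add: f_D D0)
  have nz: "?f n \<noteq> 0" for n
    using f0[of n] by auto
  have "subdegree (?f k - 1) > n" if "k > n" for n k
  proof -
    have "?f k * D k = 1"
      using inverse_mult_eq_1[of "D k"] D0[of k] by (simp add: f_D)
    hence "?f k - 1 = ?f k * (1 - D k)"
      by (simp add: algebra_simps)
    also have "1 - D k = fps_X ^ (k + 1) * (1 + fps_X ^ (k + 1) - fps_X ^ (2 * (k + 1)))"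
      by (simp add: D_def algebra_simps mult_2 flip: power_add)
    finally have eq: "?f k - 1 = fps_X ^ (k + 1) *
        (?f k * (1 + fps_X ^ (k + 1) - fps_X ^ (2 * (k + 1))))"
      by (simp only: mult_ac)
    have "fps_nth (?f k * (1 + fps_X ^ (k + 1) - fps_X ^ (2 * (k + 1)))) 0 = 1"
      by (simp add: f0)
    hence "fps_nth (?f k - 1) (k + 1) = 1"
      unfolding eq by (subst fps_X_power_mult_nth) simp
    hence ne: "?f k - 1 \<noteq> 0"
      by (metis fps_zero_nth zero_neq_one)
    have "fps_nth (?f k - 1) i = 0" if "i \<le> k" for i
      unfolding eq using that by (subst fps_X_power_mult_nth) simp
    thus ?thesis
      using \<open>k > n\<close> ne by (intro subdegree_greaterI) auto
  qed
  hence "\<exists>P. (\<lambda>N. \<Prod>k\<le>N. ?f k) \<longlonglongrightarrow> P"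
    using tendsto_prod_fps[of ?f "\<lambda>n. n", OF nz] by blast
  then obtain P where lim: "(\<lambda>N. \<Prod>k\<le>N. ?f k) \<longlonglongrightarrow> P"
    by blast
  have prod0: "fps_nth (\<Prod>k\<le>N. ?f k) 0 = 1" for N
    by (induction N) (simp_all add: f0)
  have "P \<noteq> 0"
  proof
    assume "P = 0"
    hence "\<forall>\<^sub>F N in sequentially. fps_nth (\<Prod>k\<le>N. ?f k) 0 = 0"
      using lim unfolding tendsto_fps_iff by auto
    thus False
      by (simp add: prod0)
  qed
  hence "?f has_prod P"
    using lim by (simp add: has_prod_def raw_has_prod_def)
  thus ?thesis
    unfolding cubic_partition_gf_def using has_prod_unique by blast
qed

end

theory Submission
  imports
    Defs
    "HOL-Complex_Analysis.Complex_Analysis"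
    "HOL-Probability.Distributions"
    "HOL-Real_Asymp.Real_Asymp"
begin

text \<open>
  The generating function is \<open>F(q) = P(q) P(q\<^sup>2)\<close>, where \<open>P(q)\<close> is the product of
  \<open>1 / (1 - q^k)\<close> over \<open>k \<ge> 1\<close>, and \<open>P\<close> is a modular form up to elementary
  factors: with \<open>q = exp (- 2 \<pi> a)\<close>, the value of \<open>log P\<close> at \<open>a\<close> exceeds that at
  \<open>1 / a\<close> by \<open>\<pi> / (12 a) - \<pi> a / 12 + (log a) / 2\<close> (\<open>log_euler_inversion\<close>). Applying
  this to both
  factors gives
  \<open>F(exp (- t)) = t / (sqrt 2 \<pi>) * exp (\<pi>\<^sup>2 / (4 t) - t / 8) * exp R(t)\<close>
  (\<open>cubic_gf_fun_modular\<close>), where \<open>R(t)\<close> is exponentially small as \<open>t\<close> tends to \<open>0\<close> in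
  a sector around the positive axis.

  By Cauchy's formula, \<open>2 \<pi> \<i> a(n)\<close> is the integral of \<open>F(exp (- t)) exp (n t)\<close> along
  a path in the right half plane whose endpoints differ by \<open>2 \<pi> \<i>\<close>. The factor
  \<open>exp (- t / 8)\<close> turns \<open>n\<close> into \<open>N = n - 1 / 8\<close>. The path runs along the arc
  \<open>\<bar>t\<bar> = \<rho> = \<pi> / (2 sqrt N)\<close> and leaves it vertically at the points of argument
  \<open>\<plusminus> \<phi>\<close>, where \<open>cos \<phi> = 4 / 5\<close>. On that arc the exponent \<open>\<pi>\<^sup>2 / (4 t) + N t\<close> is
  real: it is \<open>z cos \<theta>\<close> with \<open>z = \<pi> sqrt N\<close>. Hence, up to exponentially small relative
  errors, \<open>8 sqrt 2 N a(n)\<close> is the integral of \<open>cos (2 \<theta>) exp (z cos \<theta>)\<close> over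
  \<open>\<bar>\<theta>\<bar> \<le> \<phi>\<close> (\<open>cubic_partition_vs_laplace\<close>), a piece of the Bessel function
  \<open>I\<^sub>2(z)\<close>. On the vertical pieces \<open>F\<close> is small, since its modulus is less than its value
  at \<open>\<bar>q\<bar>\<close> by a factor that is exponentially small in \<open>1 / \<rho>\<close> (\<open>minor_arc_bound\<close>).

  The substitution \<open>s = 2 sin (\<theta> / 2)\<close> makes the integral Gaussian, and its expansion is
  \<open>exp z * sqrt (2 \<pi> / z) * (1 - 15 / (8 z) + O(1 / z\<^sup>2))\<close> (\<open>laplace_arc_integral\<close>).
  Thus \<open>a(n) = exp z / (8 N powr (5 / 4)) * (1 - 15 / (8 z) + o(1 / z))\<close>. Taking logarithms,
  the coefficient of \<open>1 / sqrt n\<close> collects \<open>- 15 / (8 \<pi>)\<close> from the Bessel expansion and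
  \<open>- \<pi> / 16\<close> from \<open>\<pi> sqrt (n - 1 / 8)\<close>.

  The inversion formula is first proved for rational \<open>a > 0\<close>. The logarithm of \<open>P\<close> is the
  sum of \<open>1 / (m (exp (2 \<pi> a m) - 1))\<close> over \<open>m \<ge> 1\<close>, and partial fractions turn this, up to
  elementary terms, into a double sum of \<open>a / (\<pi> (m\<^sup>2 a\<^sup>2 + k\<^sup>2))\<close>, which is symmetric under \<open>a \<mapsto> 1 / a\<close> together with
  an exchange of \<open>m\<close> and \<open>k\<close>. The double series diverges, so it is truncated to
  \<open>m \<le> M\<close>, \<open>k \<le> K\<close> with \<open>K = a M\<close>; the two remainders then have the same limit, and the
  divergent harmonic sums leave \<open>(log a) / 2\<close>. The identity theorem extends the formula to the
  half plane.
\<close>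

section \<open>Partial fractions of \<open>1 / (exp (2 \<pi> x) - 1)\<close>\<close>

text \<open>
  Euler's product for the sine, at the imaginary point \<open>\<i> x\<close>.
\<close>

lemma sinh_product_sums_ln:
  fixes x :: real
  assumes x: "x > 0"
  shows "(\<lambda>k. ln (1 + x\<^sup>2 / (real (Suc k))\<^sup>2)) sums ln (sinh (pi * x) / (pi * x))"
proof -
  have "(\<lambda>n. of_real pi * (\<i> * of_real x) * (\<Prod>k=1..n. 1 - (\<i> * of_real x)^2 / of_nat k^2))
          \<longlonglongrightarrow> sin (of_real pi * (\<i> * complex_of_real x))"
    by (rule sin_product_formula_complex)
  also have "sin (of_real pi * (\<i> * complex_of_real x)) = \<i> * of_real (sinh (pi * x))"
  proof -
    have "sin (\<i> * complex_of_real (pi * x)) = \<i> * sinh (complex_of_real (pi * x))"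
      by (simp add: sin_conv_sinh)
    also have "sinh (complex_of_real (pi * x)) = of_real (sinh (pi * x))"
      by (simp add: sinh_field_def flip: exp_of_real)
    finally show ?thesis by (simp add: mult_ac)
  qed
  finally have "(\<lambda>n. (- \<i> / of_real (pi * x)) *
       (of_real pi * (\<i> * of_real x) * (\<Prod>k=1..n. 1 - (\<i> * of_real x)^2 / of_nat k^2)))
       \<longlonglongrightarrow> (- \<i> / of_real (pi * x)) * (\<i> * of_real (sinh (pi * x)))"
    by (rule tendsto_mult_left)
  also have "(\<lambda>n. (- \<i> / of_real (pi * x)) *
       (of_real pi * (\<i> * of_real x) * (\<Prod>k=1..n. 1 - (\<i> * of_real x)^2 / of_nat k^2)))
     = (\<lambda>n. of_real (\<Prod>k=1..n. 1 + x^2 / (real k)^2))"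
    using x by (simp add: field_simps power_mult_distrib)
  also have "(- \<i> / of_real (pi * x)) * (\<i> * of_real (sinh (pi * x)))
     = complex_of_real (sinh (pi * x) / (pi * x))"
    using x by (simp add: field_simps)
  finally have lim: "(\<lambda>n. \<Prod>k=1..n. 1 + x^2 / (real k)^2) \<longlonglongrightarrow> sinh (pi * x) / (pi * x)"
    by (subst (asm) tendsto_of_real_iff)
  have pos: "sinh (pi * x) / (pi * x) > 0"
    using x by simp
  have "(\<lambda>n. ln (\<Prod>k=1..n. 1 + x^2 / (real k)^2)) \<longlonglongrightarrow> ln (sinh (pi * x) / (pi * x))"
    by (rule tendsto_ln[OF lim]) (use pos in linarith)
  also have "(\<lambda>n. ln (\<Prod>k=1..n. 1 + x^2 / (real k)^2))
      = (\<lambda>n. \<Sum>k<n. ln (1 + x\<^sup>2 / (real (Suc k))\<^sup>2))"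
  proof
    fix n
    have p: "1 + x^2 / (real k)^2 = 0 \<longleftrightarrow> False" for k
      using add_pos_nonneg[of 1 "x^2 / (real k)^2"] by auto
    have "ln (\<Prod>k=1..n. 1 + x^2 / (real k)^2) = (\<Sum>k=1..n. ln (1 + x^2 / (real k)^2))"
      by (intro ln_prod) (simp_all only: finite_atLeastAtMost p not_False_eq_True)
    also have "\<dots> = (\<Sum>k<n. ln (1 + x\<^sup>2 / (real (Suc k))\<^sup>2))"
      using sum.atLeast1_atMost_eq[of "\<lambda>k. ln (1 + x^2 / (real k)^2)" n] by simp
    finally show "ln (\<Prod>k=1..n. 1 + x^2 / (real k)^2) = (\<Sum>k<n. ln (1 + x\<^sup>2 / (real (Suc k))\<^sup>2))" .
  qed
  finally show ?thesis by (simp add: sums_def)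
qed

text \<open>
  The logarithmic derivative of the product for \<open>sinh\<close>, taken term by term: the differentiated
  series converges uniformly on bounded intervals.
\<close>

lemma coth_partial_fractions:
  fixes x :: real
  assumes x: "x > 0"
  shows "(\<lambda>k. 2 * x / (x\<^sup>2 + (real (Suc k))\<^sup>2)) sums (pi * cosh (pi * x) / sinh (pi * x) - 1 / x)"
proof -
  define f where "f = (\<lambda>k (y::real). ln (1 + y\<^sup>2 / (real (Suc k))\<^sup>2))"
  define f' where "f' = (\<lambda>k (y::real). 2 * y / (y\<^sup>2 + (real (Suc k))\<^sup>2))"
  let ?S = "{0<..<x+1}"
  have der: "(f k has_field_derivative f' k y) (at y within ?S)" if "y \<in> ?S" for k y
  proof -
    define K where "K = (real (Suc k))\<^sup>2"
    have K: "K > 0" by (simp add: K_def)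
    have p: "1 + y\<^sup>2 / K > 0" using K by (intro add_pos_nonneg) auto
    have n: "y\<^sup>2 + K > 0" using K by (intro add_nonneg_pos) auto
    have "((\<lambda>y. ln (1 + y\<^sup>2 / K)) has_field_derivative (2 * y / K) / (1 + y\<^sup>2 / K)) (at y within ?S)"
      using p K by (auto intro!: derivative_eq_intros)
    also have "(2 * y / K) / (1 + y\<^sup>2 / K) = 2 * y / (y\<^sup>2 + K)"
      using K n p by (simp add: divide_simps add.commute)
    finally show ?thesis unfolding f_def f'_def K_def .
  qed
  have unif: "uniformly_convergent_on ?S (\<lambda>n y. \<Sum>k<n. f' k y)"
  proof (rule Weierstrass_m_test'_ev[where M = "\<lambda>k. 2 * (x+1) * (1 / (real (Suc k))\<^sup>2)"])
    show "summable (\<lambda>k. 2 * (x+1) * (1 / (real (Suc k))\<^sup>2))"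
      by (intro summable_mult) (use sums_summable[OF inverse_squares_sums] in \<open>simp add: add.commute\<close>)
    show "\<forall>\<^sub>F n in sequentially. \<forall>y\<in>?S. norm (f' n y) \<le> 2 * (x+1) * (1 / (real (Suc n))\<^sup>2)"
    proof (intro always_eventually allI ballI)
      fix n y assume y: "y \<in> ?S"
      have "f' n y \<le> 2 * (x+1) / (real (Suc n))\<^sup>2"
        unfolding f'_def using y by (intro frac_le) auto
      moreover have "f' n y \<ge> 0" using y by (simp add: f'_def)
      ultimately show "norm (f' n y) \<le> 2 * (x+1) * (1 / (real (Suc n))\<^sup>2)" by simp
    qed
  qed
  have sx: "(\<lambda>k. f k y) sums ln (sinh (pi * y) / (pi * y))" if "y > 0" for y
    unfolding f_def using sinh_product_sums_ln[OF that] .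
  have xS: "x \<in> interior ?S" using x by simp
  have *: "((\<lambda>y. \<Sum>k. f k y) has_field_derivative (\<Sum>k. f' k x)) (at x)"
    by (rule has_field_derivative_series'(2)[OF _ der unif _ _ xS, of x])
       (use x sums_summable[OF sx[of x]] in auto)
  have summ: "summable (\<lambda>k. f' k x)"
    using uniformly_convergent_imp_convergent[OF unif, of x] x by (simp add: summable_iff_convergent)
  have "((\<lambda>y. ln (sinh (pi * y) / (pi * y))) has_field_derivative (\<Sum>k. f' k x)) (at x)"
  proof (rule DERIV_cong_ev[THEN iffD1, OF refl _ refl *])
    have "eventually (\<lambda>y. y \<in> {0<..}) (nhds x)" using x by (intro eventually_nhds_in_open) auto
    thus "\<forall>\<^sub>F y in nhds x. (\<Sum>k. f k y) = ln (sinh (pi * y) / (pi * y))"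
      by eventually_elim (use sx in \<open>auto simp: sums_iff\<close>)
  qed
  moreover have "((\<lambda>y. ln (sinh (pi * y) / (pi * y))) has_field_derivative
       (pi * cosh (pi * x) / sinh (pi * x) - 1 / x)) (at x)"
  proof -
    have S: "sinh (pi * x) > 0" using x by simp
    have "((\<lambda>y. sinh (pi * y) / (pi * y)) has_field_derivative
       (((cosh (pi * x) * pi) * (pi * x) - sinh (pi * x) * pi) / ((pi * x) * (pi * x)))) (at x)"
      using x by (auto intro!: derivative_eq_intros)
    hence "((\<lambda>y. ln (sinh (pi * y) / (pi * y))) has_field_derivative
       (1 / (sinh (pi * x) / (pi * x)) *
        (((cosh (pi * x) * pi) * (pi * x) - sinh (pi * x) * pi) / ((pi * x) * (pi * x))))) (at x)"
      using S x by (intro DERIV_chain2[OF DERIV_ln_divide]) auto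
    moreover have "1 / (s / (pi * x)) * (((c * pi) * (pi * x) - s * pi) / ((pi * x) * (pi * x)))
        = pi * c / s - 1 / x" if "s > 0" for s c
      using that x by (simp add: divide_simps) algebra
    ultimately show ?thesis using S by simp
  qed
  ultimately have "(\<Sum>k. f' k x) = pi * cosh (pi * x) / sinh (pi * x) - 1 / x"
    by (rule DERIV_unique)
  with summ show ?thesis unfolding f'_def sums_iff by simp
qed

text \<open>
  The expansion of \<open>coth\<close> again, because
  \<open>coth (\<pi> x) = 1 + 2 / (exp (2 \<pi> x) - 1)\<close>.
\<close>

lemma bose_partial_fractions:
  fixes x :: real
  assumes x: "x > 0"
  shows "(\<lambda>k. x / (pi * (x\<^sup>2 + (real (Suc k))\<^sup>2))) sums
           (1 / (exp (2 * pi * x) - 1) - 1 / (2 * pi * x) + 1 / 2)"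
proof -
  define E where "E = exp (pi * x)"
  have E: "E > 1" using x by (simp add: E_def)
  have sq: "exp (2 * pi * x) = E * E"
    by (simp add: E_def flip: exp_add)
  have E2: "E * E > 1" using E by (simp add: less_1_mult)
  have "cosh (pi * x) = (E + 1 / E) / 2" "sinh (pi * x) = (E - 1 / E) / 2"
    unfolding cosh_field_def sinh_field_def E_def exp_minus inverse_eq_divide by simp_all
  moreover have "(u / 2) / (v / 2) = u / v" for u v :: real
    by simp
  ultimately have "cosh (pi * x) / sinh (pi * x) = (E + 1 / E) / (E - 1 / E)"
    by metis
  also have "\<dots> = (E * E + 1) / (E * E - 1)"
    using E E2 by (simp add: divide_simps)
  finally have c: "cosh (pi * x) / sinh (pi * x) = (E * E + 1) / (E * E - 1)" .
  have "(\<lambda>k. (1 / (2 * pi)) * (2 * x / (x\<^sup>2 + (real (Suc k))\<^sup>2))) sums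
     ((1 / (2 * pi)) * (pi * cosh (pi * x) / sinh (pi * x) - 1 / x))"
    by (rule sums_mult[OF coth_partial_fractions[OF x]])
  also have "(1 / (2 * pi)) * (pi * cosh (pi * x) / sinh (pi * x) - 1 / x)
      = (1/2) * (cosh (pi * x) / sinh (pi * x)) - 1 / (2 * pi * x)"
    by (simp add: right_diff_distrib)
  also have "(1/2) * (cosh (pi * x) / sinh (pi * x)) = 1 / (exp (2 * pi * x) - 1) + 1 / 2"
    unfolding c sq using E2 by (simp add: divide_simps) (simp add: algebra_simps)
  finally show ?thesis by (simp add: add_ac algebra_simps)
qed

section \<open>Inversion of the logarithm of the Euler product at rational points\<close>

text \<open>
  A Riemann sum of \<open>arctan x / x\<close> over the unit interval. Both remainders of the truncated
  double sum are asymptotic to it, and all that matters is that it converges.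
\<close>

definition arctan_sum :: "nat \<Rightarrow> real" where
  "arctan_sum M = (\<Sum>m=1..M. arctan (real m / real M) / real m)"

lemma arctan_over_self_antimono:
  fixes x y :: real
  assumes "0 < x" "x \<le> y"
  shows "arctan y / y \<le> arctan x / x"
proof (rule DERIV_nonpos_imp_nonincreasing[OF assms(2)])
  fix t :: real assume "x \<le> t" "t \<le> y"
  hence t: "t > 0" using assms by simp
  have "arctan t / t \<ge> 1 / (1 + t\<^sup>2)"
  proof -
    have "\<exists>z>0. z < t \<and> arctan t - arctan 0 = (t - 0) * inverse (1 + z\<^sup>2)"
      by (rule MVT2[OF t]) (auto intro!: derivative_eq_intros)
    then obtain z where z: "0 < z" "z < t" "arctan t = t * inverse (1 + z\<^sup>2)" by auto
    have "1 / (1 + t\<^sup>2) \<le> 1 / (1 + z\<^sup>2)"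
      using z by (intro frac_le add_left_mono power_mono) (auto intro: add_pos_nonneg)
    thus ?thesis using z t by (simp add: inverse_eq_divide)
  qed
  hence "1 / (1 + t\<^sup>2) / t \<le> arctan t / t / t"
    using t by (intro divide_right_mono) auto
  hence "1 / (1 + t\<^sup>2) / t - arctan t / t / t \<le> 0" by linarith
  moreover have "((\<lambda>t. arctan t / t) has_field_derivative
      (1 / (1 + t\<^sup>2) / t - arctan t / t / t)) (at t)"
    using t by (auto intro!: derivative_eq_intros simp: inverse_eq_divide diff_divide_distrib)
  ultimately show "\<exists>d. ((\<lambda>t. arctan t / t) has_field_derivative d) (at t) \<and> d \<le> 0"
    by blast
qed

lemma arctan_le_self:
  fixes x :: real
  assumes "x \<ge> 0" shows "arctan x \<le> x"
proof (cases "x = 0")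
  case False
  with assms have x: "x > 0" by simp
  have "\<exists>z>0. z < x \<and> arctan x - arctan 0 = (x - 0) * inverse (1 + z\<^sup>2)"
    by (rule MVT2[OF x]) (auto intro!: derivative_eq_intros)
  then obtain z where z: "0 < z" "arctan x = x * inverse (1 + z\<^sup>2)" by auto
  have "inverse (1 + z\<^sup>2) \<le> 1" by (simp add: inverse_eq_divide divide_le_eq_1 add_pos_nonneg)
  hence "x * inverse (1 + z\<^sup>2) \<le> x * 1" using x by (intro mult_left_mono) auto
  with z show ?thesis by simp
qed auto

text \<open>
  Because \<open>arctan x / x\<close> is decreasing, the sum and the integral of \<open>x \<mapsto> \<phi> (x / M)\<close> over
  \<open>[0, M]\<close> differ by a bounded amount, and after division by \<open>M\<close> the difference vanishes.
\<close>

lemma arctan_sum_convergent: "\<exists>L. arctan_sum \<longlonglongrightarrow> L"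
proof -
  define \<phi> where "\<phi> = (\<lambda>x::real. if x = 0 then 1 else arctan x / x)"
  have \<phi>_le1: "\<phi> x \<le> 1" if "x \<ge> 0" for x
    using that arctan_le_self[of x] by (auto simp: \<phi>_def divide_le_eq_1)
  have dec: "\<phi> y \<le> \<phi> x" if "0 \<le> x" "x \<le> y" for x y
  proof (cases "x = 0")
    case True thus ?thesis using \<phi>_le1[of y] that by (simp add: \<phi>_def)
  next
    case False thus ?thesis using that arctan_over_self_antimono[of x y] by (simp add: \<phi>_def)
  qed
  have nonneg: "\<phi> x \<ge> 0" if "x \<ge> 0" for x
    using that by (auto simp: \<phi>_def)
  have cont: "continuous_on {0..} \<phi>"
  proof (rule continuous_at_imp_continuous_on, intro ballI)
    fix x :: real
    have "(\<lambda>x::real. arctan x / x) \<midarrow>0\<rightarrow> 1"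
      using DERIV_arctan[of 0] by (simp add: DERIV_def)
    hence "\<phi> \<midarrow>0\<rightarrow> 1"
      by (rule Lim_transform_eventually) (auto simp: \<phi>_def eventually_at_filter)
    moreover have "\<phi> 0 = 1" by (simp add: \<phi>_def)
    ultimately have c0: "isCont \<phi> 0" by (simp add: isCont_def)
    show "isCont \<phi> x"
    proof (cases "x = 0")
      case False
      have "isCont (\<lambda>x. arctan x / x) x" using False by (intro continuous_intros isCont_arctan) auto
      moreover have "eventually (\<lambda>y. y \<in> -{0}) (nhds x)"
        using False by (intro eventually_nhds_in_open) auto
      hence "eventually (\<lambda>y. arctan y / y = \<phi> y) (nhds x)"
        by eventually_elim (auto simp: \<phi>_def)
      ultimately show ?thesis using isCont_cong by force
    qed (use c0 in auto)
  qed
  define L where "L = integral {0..1} \<phi>"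
  have hi: "(\<phi> has_integral L) {0..1}"
    unfolding L_def by (intro integrable_integral integrable_continuous_real continuous_on_subset[OF cont]) auto
  have "norm (arctan_sum M - L) \<le> 2 / real M" if M: "M > 0" for M
  proof -
    define f where "f = (\<lambda>x. \<phi> (x / real M))"
    interpret antimono_fun_sum_integral_diff f
    proof
      show "f y \<le> f x" if "0 \<le> x" "x \<le> y" for x y
        unfolding f_def using that M by (intro dec) (auto simp: divide_right_mono)
      show "f x \<ge> 0" if "0 \<le> x" for x
        unfolding f_def using that by (intro nonneg) auto
      show "continuous_on {0..} f"
        unfolding f_def using M
        by (intro continuous_on_compose2[OF cont] continuous_intros) auto
    qed
    have "((\<lambda>x. \<phi> ((1 / real M) * x)) has_integral (1 / \<bar>1 / real M\<bar>) *\<^sub>R L) ((\<lambda>x. x / (1 / real M)) ` {0..1})"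
      using hi M by (intro has_integral_stretch_real) (auto simp: cbox_interval)
    also have "((\<lambda>x. x / (1 / real M)) ` {0..1}) = {0..real M}"
      using image_mult_atLeastAtMost[of "real M" 0 1] M by (simp add: mult.commute)
    finally have "(f has_integral (real M * L)) {0..real M}" using M by (simp add: f_def)
    hence int: "integral {0..real M} f = real M * L" by (rule integral_unique)
    have s: "(\<Sum>k\<le>M. f (real k)) = 1 + real M * arctan_sum M"
    proof -
      have "(\<Sum>k\<le>M. f (real k)) = f 0 + (\<Sum>k=1..M. f (real k))"
        using sum.atMost_shift[of "\<lambda>k. f (real k)" M] sum.atLeast1_atMost_eq[of "\<lambda>k. f (real k)" M]
        by simp
      also have "f 0 = 1" by (simp add: f_def \<phi>_def)
      also have "(\<Sum>k=1..M. f (real k)) = real M * arctan_sum M"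
        unfolding arctan_sum_def sum_distrib_left using M
        by (intro sum.cong) (auto simp: f_def \<phi>_def)
      finally show ?thesis .
    qed
    have "sum_integral_diff_series M \<ge> 0" "sum_integral_diff_series M \<le> sum_integral_diff_series 0"
      by (rule sum_integral_diff_series_nonneg, rule sum_integral_diff_series_antimono) auto
    moreover have "sum_integral_diff_series 0 = 1" unfolding sum_integral_diff_series_def by (simp add: f_def \<phi>_def)
    moreover have "sum_integral_diff_series M = 1 + real M * (arctan_sum M - L)"
      by (simp add: sum_integral_diff_series_def s int algebra_simps)
    ultimately have "\<bar>real M * (arctan_sum M - L)\<bar> \<le> 2" by linarith
    hence "real M * \<bar>arctan_sum M - L\<bar> \<le> 2" by (simp add: abs_mult)
    thus ?thesis using M by (simp add: field_simps)
  qed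
  hence "eventually (\<lambda>M. norm (arctan_sum M - L) \<le> 2 / real M) sequentially"
    by (rule eventually_mono[OF eventually_gt_at_top[of 0]])
  hence "(\<lambda>M. arctan_sum M - L) \<longlonglongrightarrow> 0"
    by (rule Lim_null_comparison) real_asymp
  thus ?thesis using LIM_zero_iff by blast
qed

text \<open>
  The terms of the partial fraction expansion of \<open>1 / (m (exp (2 \<pi> a m) - 1))\<close>, whose second
  factor is the Bose-Einstein weight.
\<close>

definition bose_term :: "real \<Rightarrow> nat \<Rightarrow> nat \<Rightarrow> real" where
  "bose_term a m k = a / (pi * ((real m * a)\<^sup>2 + (real k)\<^sup>2))"

text \<open>
  This is the symmetry behind the inversion formula.
\<close>

lemma bose_term_inverse:
  assumes "a > 0"
  shows "bose_term (1 / a) k m = bose_term a m k"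
proof -
  have "(real k * (1 / a))\<^sup>2 + (real m)\<^sup>2 = ((real m * a)\<^sup>2 + (real k)\<^sup>2) / a\<^sup>2"
    using assms by (simp add: field_simps)
  thus ?thesis unfolding bose_term_def using assms by (simp add: power2_eq_square)
qed

lemma bose_term_sums:
  assumes "a > 0" "m > 0"
  shows "(\<lambda>k. bose_term a m (Suc k)) sums
    (1 / (real m * (exp (2 * pi * a * real m) - 1)) - 1 / (2 * pi * a * (real m)\<^sup>2) + 1 / (2 * real m))"
proof -
  have "(\<lambda>k. (real m * a) / (pi * ((real m * a)\<^sup>2 + (real (Suc k))\<^sup>2)) / real m) sums
     ((1 / (exp (2 * pi * (real m * a)) - 1) - 1 / (2 * pi * (real m * a)) + 1 / 2) / real m)"
    by (intro sums_divide bose_partial_fractions) (use assms in auto)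
  also have "(\<lambda>k. (real m * a) / (pi * ((real m * a)\<^sup>2 + (real (Suc k))\<^sup>2)) / real m) = (\<lambda>k. bose_term a m (Suc k))"
    using assms by (simp add: bose_term_def)
  also have "(1 / (exp (2 * pi * (real m * a)) - 1) - 1 / (2 * pi * (real m * a)) + 1 / 2) / real m
     = 1 / (real m * (exp (2 * pi * a * real m) - 1)) - 1 / (2 * pi * a * (real m)\<^sup>2) + 1 / (2 * real m)"
    by (simp add: add_divide_distrib diff_divide_distrib power2_eq_square mult_ac)
  finally show ?thesis .
qed

text \<open>
  The tail over \<open>k\<close> is compared with the telescoping sum of
  \<open>arctan (m a / k) / (\<pi> m)\<close>: by the mean value theorem each difference lies between two
  consecutive terms of the tail.
\<close>

lemma bose_tail_bounds:
  assumes a: "a > 0" and m: "m > 0" and K: "K > 0"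
  defines "A \<equiv> (\<lambda>k. arctan (real m * a / real k) / (pi * real m))"
  defines "T \<equiv> (\<Sum>k. bose_term a m (Suc (k + K)))"
  shows "A K - a / (pi * (real K)\<^sup>2) \<le> T" "T \<le> A K"
proof -
  have step: "bose_term a m (Suc k) \<le> A k - A (Suc k) \<and> A k - A (Suc k) \<le> bose_term a m k"
    if k: "k > 0" for k
  proof -
    define c where "c = real m * a"
    have c: "c > 0" using a m by (simp add: c_def)
    have kk: "real k < real (Suc k)" by simp
    have "\<exists>z>real k. z < real (Suc k) \<and>
        (- arctan (c / real (Suc k))) - (- arctan (c / real k)) = (real (Suc k) - real k) * (c / (c\<^sup>2 + z\<^sup>2))"
    proof (rule MVT2[OF kk])
      fix z :: real assume "real k \<le> z"
      hence z: "z > 0" using k by simp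
      have "((\<lambda>z. - arctan (c / z)) has_field_derivative
          - (inverse (1 + (c / z)\<^sup>2) * (- c / z\<^sup>2))) (at z)"
        using z by (auto intro!: derivative_eq_intros simp: power2_eq_square)
      also have "- (inverse (1 + (c / z)\<^sup>2) * (- c / z\<^sup>2)) = c / (c\<^sup>2 + z\<^sup>2)"
      proof -
        have "1 + (c / z)\<^sup>2 = (c\<^sup>2 + z\<^sup>2) / z\<^sup>2" using z by (simp add: field_simps)
        thus ?thesis using z by (simp add: field_simps)
      qed
      finally show "((\<lambda>z. - arctan (c / z)) has_field_derivative c / (c\<^sup>2 + z\<^sup>2)) (at z)" .
    qed
    then obtain z where z: "real k < z" "z < real (Suc k)"
      "arctan (c / real k) - arctan (c / real (Suc k)) = c / (c\<^sup>2 + z\<^sup>2)"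
      by auto
    have "A k - A (Suc k) = (arctan (c / real k) - arctan (c / real (Suc k))) / (pi * real m)"
      by (simp add: A_def c_def diff_divide_distrib)
    also have "\<dots> = a / (pi * (c\<^sup>2 + z\<^sup>2))"
      unfolding z using m by (simp add: c_def)
    finally have e: "A k - A (Suc k) = a / (pi * (c\<^sup>2 + z\<^sup>2))" .
    have p: "c\<^sup>2 + y > 0" if "y \<ge> 0" for y using c that by (simp add: add_pos_nonneg)
    have "z\<^sup>2 \<le> (real (Suc k))\<^sup>2" "(real k)\<^sup>2 \<le> z\<^sup>2"
      using z by (auto intro!: power_mono)
    thus ?thesis unfolding e bose_term_def c_def[symmetric] using a p
      by (intro conjI divide_left_mono mult_left_mono add_left_mono mult_pos_pos) auto
  qed
  have A0: "A \<longlonglongrightarrow> 0"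
  proof -
    have "(\<lambda>k. real m * a / real k) \<longlonglongrightarrow> 0" by real_asymp
    hence "(\<lambda>k. arctan (real m * a / real k)) \<longlonglongrightarrow> arctan 0" by (rule tendsto_arctan)
    hence "(\<lambda>k. arctan (real m * a / real k) / (pi * real m)) \<longlonglongrightarrow> arctan 0 / (pi * real m)"
      using m by (intro tendsto_divide tendsto_const) auto
    thus ?thesis by (simp add: A_def)
  qed
  have tele: "(\<lambda>k. A (k + K) - A (Suc k + K)) sums (A (0 + K) - 0)"
    by (intro telescope_sums'[of "\<lambda>k. A (k + K)"] LIMSEQ_ignore_initial_segment A0)
  have sm: "summable (\<lambda>k. bose_term a m (Suc k))"
    using bose_term_sums[OF a m] by (rule sums_summable)
  have smT: "summable (\<lambda>k. bose_term a m (Suc (k + K)))"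
    using summable_ignore_initial_segment[OF sm, of K] by simp
  have smB: "summable (\<lambda>k. bose_term a m (k + K))"
    using summable_ignore_initial_segment[of "\<lambda>k. bose_term a m k" K] sm
    by (simp add: summable_Suc_iff)
  have "T \<le> (\<Sum>k. A (k + K) - A (Suc k + K))"
    unfolding T_def using step K by (intro suminf_le smT sums_summable[OF tele]) auto
  thus "T \<le> A K" using tele by (simp add: sums_iff)
  have "(\<Sum>k. A (k + K) - A (Suc k + K)) \<le> (\<Sum>k. bose_term a m (k + K))"
    using step K by (intro suminf_le smB sums_summable[OF tele]) auto
  also have "(\<Sum>k. bose_term a m (k + K)) = bose_term a m K + T"
    using suminf_split_head[OF smB] by (simp add: T_def)
  also have "bose_term a m K \<le> a / (pi * (real K)\<^sup>2)"
    unfolding bose_term_def using a K by (intro divide_left_mono mult_left_mono) (auto intro!: mult_pos_pos add_nonneg_pos)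
  finally show "A K - a / (pi * (real K)\<^sup>2) \<le> T" using tele by (simp add: sums_iff)
qed

text \<open>
  The balanced truncation \<open>K = a M\<close> makes the argument \<open>m a / K\<close> of the arctangent equal to
  \<open>m / M\<close>, so that the main term no longer depends on \<open>a\<close>.
\<close>

lemma bose_tails_sum:
  assumes a: "a > 0" and MK: "real K = a * real M" and M: "M > 0"
  shows "\<bar>(\<Sum>m=1..M. \<Sum>k. bose_term a m (Suc (k + K))) - arctan_sum M / pi\<bar> \<le> 1 / (pi * real K)"
proof -
  have K: "K > 0" using a M MK by (metis mult_pos_pos of_nat_0_less_iff)
  have 1: "\<bar>(\<Sum>k. bose_term a m (Suc (k + K))) - arctan (real m / real M) / (pi * real m)\<bar> \<le> a / (pi * (real K)\<^sup>2)"
    if "m \<in> {1..M}" for m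
  proof -
    have "real m * a / real K = real m / real M" unfolding MK using a by simp
    thus ?thesis using bose_tail_bounds[OF a _ K, of m] that a by (auto simp: abs_le_iff)
  qed
  have "(\<Sum>m=1..M. \<Sum>k. bose_term a m (Suc (k + K))) - arctan_sum M / pi =
     (\<Sum>m=1..M. (\<Sum>k. bose_term a m (Suc (k + K))) - arctan (real m / real M) / (pi * real m))"
    by (simp add: arctan_sum_def sum_subtractf sum_divide_distrib mult.commute)
  also have "\<bar>\<dots>\<bar> \<le> (\<Sum>m=1..M. a / (pi * (real K)\<^sup>2))"
    by (intro order.trans[OF sum_abs] sum_mono 1)
  also have "\<dots> = 1 / (pi * real K)"
    using a M unfolding MK by (simp add: power2_eq_square)
  finally show ?thesis .
qed

text \<open>
  For \<open>q = exp (- 2 \<pi> a)\<close> these are the partial sums of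
  \<open>\<Sum>m. q^m / (m (1 - q^m))\<close>, the logarithm of the product of \<open>1 / (1 - q^k)\<close>.
\<close>

definition bose_sum :: "real \<Rightarrow> nat \<Rightarrow> real" where
  "bose_sum a M = (\<Sum>m=1..M. 1 / (real m * (exp (2 * pi * a * real m) - 1)))"

lemma bose_sum_split:
  assumes a: "a > 0"
  shows "bose_sum a M = (\<Sum>m=1..M. 1 / (real m)\<^sup>2) / (2 * pi * a) - harm M / 2
     + (\<Sum>m=1..M. \<Sum>k=1..K. bose_term a m k) + (\<Sum>m=1..M. \<Sum>k. bose_term a m (Suc (k + K)))"
proof -
  have 1: "1 / (real m * (exp (2 * pi * a * real m) - 1)) =
      1 / (real m)\<^sup>2 / (2 * pi * a) - inverse (real m) / 2
       + (\<Sum>k=1..K. bose_term a m k) + (\<Sum>k. bose_term a m (Suc (k + K)))"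
    if "m \<in> {1..M}" for m
  proof -
    have m: "m > 0" using that by simp
    note s = bose_term_sums[OF a m]
    have "(\<Sum>k. bose_term a m (Suc k)) = (\<Sum>k. bose_term a m (Suc (k + K))) + (\<Sum>k<K. bose_term a m (Suc k))"
      using suminf_split_initial_segment[OF sums_summable[OF s], of K] by simp
    also have "(\<Sum>k<K. bose_term a m (Suc k)) = (\<Sum>k=1..K. bose_term a m k)"
      using sum.atLeast1_atMost_eq[of "bose_term a m" K] by simp
    finally show ?thesis using s by (simp add: sums_iff field_simps)
  qed
  show ?thesis unfolding bose_sum_def
    by (subst sum.cong[OF refl 1])
       (simp_all add: sum.distrib sum_subtractf harm_def sum_divide_distrib)
qed

text \<open>
  Both partial sums are split as in \<open>bose_sum_split\<close>, with the cut-offs exchanged. The finite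
  double sums agree by symmetry, the sums of \<open>1 / m\<^sup>2\<close> give the two terms with \<open>\<pi>\<close>, and the
  harmonic numbers give \<open>(ln K - ln M) / 2 = (ln a) / 2\<close>. Rationality of \<open>a\<close> is what allows
  \<open>K = a M\<close> to hold for infinitely many integers.
\<close>

lemma bose_sum_inversion_rational:
  assumes p: "p > 0" and r: "r > 0"
  defines "a \<equiv> real p / real r"
  assumes lim1: "bose_sum a \<longlonglongrightarrow> S" and lim2: "bose_sum (1 / a) \<longlonglongrightarrow> S'"
  shows "S - S' = pi / (12 * a) - pi * a / 12 + ln a / 2"
proof -
  have a: "a > 0" using p r by (simp add: a_def)
  define M where "M = (\<lambda>j. r * Suc j)"
  define K where "K = (\<lambda>j. p * Suc j)"
  have Mpos: "M j > 0" and Kpos: "K j > 0" for j using p r by (auto simp: M_def K_def)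
  have KM: "real (K j) = a * real (M j)" for j using r by (simp add: K_def M_def a_def field_simps)
  have MK: "real (M j) = (1 / a) * real (K j)" for j using a by (simp add: KM)
  have Mlim: "filterlim M at_top sequentially" and Klim: "filterlim K at_top sequentially"
    by (intro filterlim_subseq strict_monoI; use p r in \<open>simp add: M_def K_def\<close>)+
  define E where "E = (\<lambda>j. (\<Sum>m=1..M j. \<Sum>k. bose_term a m (Suc (k + K j))) - arctan_sum (M j) / pi)"
  define E' where "E' = (\<lambda>j. (\<Sum>k=1..K j. \<Sum>m. bose_term (1 / a) k (Suc (m + M j))) - arctan_sum (K j) / pi)"
  define H where "H = (\<lambda>M. \<Sum>m=1..M. 1 / (real m)\<^sup>2)"
  have Hlim: "H \<longlonglongrightarrow> pi\<^sup>2 / 6"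
    using inverse_squares_sums unfolding sums_def H_def by (simp add: sum.atLeast1_atMost_eq add.commute)
  have E: "E \<longlonglongrightarrow> 0"
  proof (rule Lim_null_comparison)
    show "\<forall>\<^sub>F j in sequentially. norm (E j) \<le> 1 / (pi * real (K j))"
      unfolding E_def real_norm_def by (intro always_eventually allI bose_tails_sum a KM Mpos)
    show "(\<lambda>j. 1 / (pi * real (K j))) \<longlonglongrightarrow> 0"
      by (rule filterlim_compose[OF _ Klim]) real_asymp
  qed
  have E': "E' \<longlonglongrightarrow> 0"
  proof (rule Lim_null_comparison)
    show "\<forall>\<^sub>F j in sequentially. norm (E' j) \<le> 1 / (pi * real (M j))"
      unfolding E'_def real_norm_def by (intro always_eventually allI bose_tails_sum MK Kpos) (use a in auto)
    show "(\<lambda>j. 1 / (pi * real (M j))) \<longlonglongrightarrow> 0"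
      by (rule filterlim_compose[OF _ Mlim]) real_asymp
  qed
  have swap: "(\<Sum>m=1..M j. \<Sum>k=1..K j. bose_term a m k) = (\<Sum>k=1..K j. \<Sum>m=1..M j. bose_term (1 / a) k m)" for j
    by (subst sum.swap) (simp add: bose_term_inverse a)
  have eq: "bose_sum a (M j) - bose_sum (1 / a) (K j) =
      H (M j) / (2 * pi * a) - H (K j) / (2 * pi * (1 / a))
      - ((harm (M j) - ln (real (M j))) - (harm (K j) - ln (real (K j)))) / 2 + ln a / 2
      + ((E j + arctan_sum (M j) / pi) - (E' j + arctan_sum (K j) / pi))" for j
  proof -
    have l: "ln (real (K j)) = ln a + ln (real (M j))"
      unfolding KM using a Mpos by (simp add: ln_mult)
    have a': "1 / a > 0" using a by simp
    show ?thesis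
      unfolding bose_sum_split[OF a, of "M j" "K j"] bose_sum_split[OF a', of "K j" "M j"] swap H_def E_def E'_def l
      by (simp add: diff_divide_distrib add_divide_distrib)
  qed
  obtain L where L: "arctan_sum \<longlonglongrightarrow> L" using arctan_sum_convergent by blast
  note sub = filterlim_compose[OF _ Mlim] filterlim_compose[OF _ Klim]
  have h: "(\<lambda>n. harm n - ln (real n)) \<longlonglongrightarrow> (euler_mascheroni :: real)"
    using euler_mascheroni_LIMSEQ by simp
  have "(\<lambda>j. bose_sum a (M j) - bose_sum (1 / a) (K j)) \<longlonglongrightarrow>
      (pi\<^sup>2 / 6) / (2 * pi * a) - (pi\<^sup>2 / 6) / (2 * pi * (1 / a))
      - (euler_mascheroni - euler_mascheroni) / 2 + ln a / 2
      + ((0 + L / pi) - (0 + L / pi))"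
    unfolding eq
    by (intro tendsto_intros E E' filterlim_compose[OF Hlim Mlim] filterlim_compose[OF Hlim Klim]
         filterlim_compose[OF h Mlim] filterlim_compose[OF h Klim] filterlim_compose[OF L Mlim]
         filterlim_compose[OF L Klim]) (use a in auto)
  moreover have "(\<lambda>j. bose_sum a (M j) - bose_sum (1 / a) (K j)) \<longlonglongrightarrow> S - S'"
    by (intro tendsto_diff filterlim_compose[OF lim1 Mlim] filterlim_compose[OF lim2 Klim])
  ultimately have "S - S' = (pi\<^sup>2 / 6) / (2 * pi * a) - (pi\<^sup>2 / 6) / (2 * pi * (1 / a))
      - (euler_mascheroni - euler_mascheroni) / 2 + ln a / 2 + ((0 + L / pi) - (0 + L / pi))"
    using LIMSEQ_unique by blast
  also have "\<dots> = pi / (12 * a) - pi * a / 12 + ln a / 2"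
    by (simp add: power2_eq_square)
  finally show ?thesis .
qed

section \<open>The logarithm of the Euler product in the unit disc\<close>

text \<open>
  The logarithm of the product of \<open>1 / (1 - q^k)\<close> over \<open>k \<ge> 1\<close>: the double series
  \<open>\<Sum>k m. q^(k m) / m\<close> with the sum over \<open>k\<close> carried out.
\<close>

definition log_euler :: "complex \<Rightarrow> complex" where
  "log_euler q = (\<Sum>m. q ^ Suc m / (of_nat (Suc m) * (1 - q ^ Suc m)))"

lemma norm_one_minus_power_ge:
  fixes q :: complex
  assumes "norm q < 1"
  shows "norm (1 - q ^ Suc m) \<ge> 1 - norm q"
proof -
  have "1 - norm q \<le> 1 - norm q ^ Suc m"
    using assms power_decreasing[of 1 "Suc m" "norm q"] by simp
  also have "\<dots> \<le> norm (1 - q ^ Suc m)"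
    using norm_triangle_ineq2[of 1 "q ^ Suc m"] by (simp only: norm_power norm_one)
  finally show ?thesis .
qed

text \<open>
  The numerator is arbitrary so that the bound serves both the terms of \<open>log_euler\<close> and those of
  its difference from a finite product.
\<close>

lemma log_euler_term_bound:
  fixes q w :: complex
  assumes "norm q < 1"
  shows "norm (w / (of_nat (Suc m) * (1 - q ^ Suc m))) \<le> norm w / (1 - norm q)"
proof -
  have "norm w / (norm (of_nat (Suc m) :: complex) * norm (1 - q ^ Suc m)) \<le> norm w / (1 * (1 - norm q))"
    using assms norm_one_minus_power_ge[OF assms, of m] unfolding norm_of_nat
    by (intro divide_left_mono mult_mono mult_pos_pos) (auto simp del: power_Suc)
  thus ?thesis by (simp add: norm_divide norm_mult)
qed

lemma geometric_sums_Suc: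
  fixes r :: real
  assumes "0 \<le> r" "r < 1"
  shows "(\<lambda>m. r ^ Suc m / (1 - r)) sums (r / (1 - r)\<^sup>2)"
proof -
  have "(\<lambda>m. r / (1 - r) * r ^ m) sums (r / (1 - r) * (1 / (1 - r)))"
    using assms by (intro sums_mult geometric_sums) auto
  thus ?thesis by (simp add: power2_eq_square)
qed

lemma log_euler_summable_norm:
  fixes q :: complex
  assumes "norm q < 1"
  shows "summable (\<lambda>m. norm (q ^ Suc m / (of_nat (Suc m) * (1 - q ^ Suc m))))"
proof (rule summable_comparison_test_ev)
  show "\<forall>\<^sub>F m in sequentially. norm (norm (q ^ Suc m / (of_nat (Suc m) * (1 - q ^ Suc m)))) \<le> norm q ^ Suc m / (1 - norm q)"
    unfolding real_norm_def abs_norm_cancel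
    by (intro always_eventually allI order.trans[OF log_euler_term_bound[OF assms]]) (simp only: norm_power order_refl)
  show "summable (\<lambda>m. norm q ^ Suc m / (1 - norm q))"
    using geometric_sums_Suc[of "norm q"] assms by (intro sums_summable) auto
qed

lemma log_euler_sums:
  fixes q :: complex
  assumes "norm q < 1"
  shows "(\<lambda>m. q ^ Suc m / (of_nat (Suc m) * (1 - q ^ Suc m))) sums log_euler q"
  unfolding log_euler_def
  by (rule summable_sums[OF summable_norm_cancel[OF log_euler_summable_norm[OF assms]]])

lemma norm_log_euler_le:
  fixes q :: complex
  assumes "norm q < 1"
  shows "norm (log_euler q) \<le> norm q / (1 - norm q)\<^sup>2"
proof -
  have g: "(\<lambda>m. norm q ^ Suc m / (1 - norm q)) sums (norm q / (1 - norm q)\<^sup>2)"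
    using assms by (intro geometric_sums_Suc) auto
  show ?thesis
  proof (rule norm_sums_le[OF log_euler_sums[OF assms] g])
    fix m
    show "norm (q ^ Suc m / (of_nat (Suc m) * (1 - q ^ Suc m))) \<le> norm q ^ Suc m / (1 - norm q)"
      using log_euler_term_bound[OF assms, of "q ^ Suc m" m] by (simp only: norm_power)
  qed
qed

lemma holomorphic_log_euler: "log_euler holomorphic_on ball 0 1"
proof (rule holomorphic_uniform_sequence[OF open_ball])
  fix n
  have "1 - q ^ Suc m \<noteq> 0" if "norm q < 1" for q :: complex and m
    using norm_one_minus_power_ge[OF that, of m] that by auto
  thus "(\<lambda>q. \<Sum>m<n. q ^ Suc m / (of_nat (Suc m) * (1 - q ^ Suc m))) holomorphic_on ball 0 1"
    by (intro holomorphic_intros) (auto simp del: power_Suc of_nat_Suc)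
next
  fix x :: complex assume x: "x \<in> ball 0 1"
  define d where "d = (1 - norm x) / 2"
  define r where "r = (1 + norm x) / 2"
  have r: "0 \<le> r" "r < 1" using x by (auto simp: r_def)
  have nr: "norm y \<le> r" if "y \<in> cball x d" for y
    using norm_triangle_sub[of y x] that by (simp add: dist_norm norm_minus_commute r_def d_def field_simps)
  have d: "d > 0" "cball x d \<subseteq> ball 0 1"
    using x nr r(2) by (force simp: d_def)+
  have "uniform_limit (cball x d) (\<lambda>n q. \<Sum>m<n. q ^ Suc m / (of_nat (Suc m) * (1 - q ^ Suc m)))
      (\<lambda>q. \<Sum>m. q ^ Suc m / (of_nat (Suc m) * (1 - q ^ Suc m))) sequentially"
  proof (rule Weierstrass_m_test)
    show "summable (\<lambda>m. r ^ Suc m / (1 - r))"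
      using geometric_sums_Suc[OF r] by (rule sums_summable)
    fix m y assume y: "y \<in> cball x d"
    have ny: "norm y \<le> r" "norm y < 1" using nr[OF y] r by auto
    have "norm (y ^ Suc m / (of_nat (Suc m) * (1 - y ^ Suc m))) \<le> norm (y ^ Suc m) / (1 - norm y)"
      by (rule log_euler_term_bound) fact
    also have "\<dots> \<le> r ^ Suc m / (1 - r)"
      unfolding norm_power using ny r by (intro frac_le power_mono) auto
    finally show "norm (y ^ Suc m / (of_nat (Suc m) * (1 - y ^ Suc m))) \<le> r ^ Suc m / (1 - r)" .
  qed
  thus "\<exists>d>0. cball x d \<subseteq> ball 0 1 \<and> uniform_limit (cball x d)
     (\<lambda>n q. \<Sum>m<n. q ^ Suc m / (of_nat (Suc m) * (1 - q ^ Suc m))) log_euler sequentially"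
    unfolding log_euler_def[abs_def] using d by blast
qed

text \<open>
  The logarithm \<open>w\<close> of the finite product is the same double series with \<open>k \<le> K\<close>. Summing the
  finite geometric series over \<open>k\<close> leaves the terms of \<open>log_euler\<close> times \<open>1 - q^(m K)\<close>.
\<close>

lemma euler_partial_product:
  fixes q :: complex
  assumes q: "norm q < 1"
  shows "\<exists>w. (\<Prod>k<K. 1 / (1 - q ^ Suc k)) = exp w \<and>
             norm (w - log_euler q) \<le> norm q ^ Suc K / (1 - norm q)\<^sup>2"
proof (intro exI conjI)
  define w where "w = (\<Sum>k<K. - Ln (1 - q ^ Suc k))"
  have qk: "norm (q ^ Suc k) < 1" for k
    unfolding norm_power using q power_decreasing[of 1 "Suc k" "norm q"] by simp
  have ne: "1 - q ^ Suc k \<noteq> 0" for k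
    using qk[of k] by auto
  have "exp w = (\<Prod>k<K. exp (- Ln (1 - q ^ Suc k)))"
    unfolding w_def by (simp add: exp_sum)
  also have "\<dots> = (\<Prod>k<K. 1 / (1 - q ^ Suc k))"
    using ne by (intro prod.cong) (auto simp: exp_minus inverse_eq_divide simp del: power_Suc)
  finally show "(\<Prod>k<K. 1 / (1 - q ^ Suc k)) = exp w" ..
  have "(\<lambda>m. \<Sum>k<K. (q ^ Suc k) ^ Suc m / of_nat (Suc m)) sums w"
    unfolding w_def
  proof (rule sums_sum)
    fix k
    have "(\<lambda>n. - ((- (- (q ^ Suc k))) ^ n) / of_nat n) sums ln (1 + - (q ^ Suc k))"
      using qk[of k] by (intro Ln_series') auto
    hence "(\<lambda>n. - (- ((q ^ Suc k) ^ n) / of_nat n)) sums - Ln (1 - q ^ Suc k)"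
      by (intro sums_minus) (simp del: power_Suc)
    hence "(\<lambda>n. (q ^ Suc k) ^ n / of_nat n) sums - Ln (1 - q ^ Suc k)"
      by (simp del: power_Suc)
    thus "(\<lambda>m. (q ^ Suc k) ^ Suc m / of_nat (Suc m)) sums - Ln (1 - q ^ Suc k)"
      by (subst sums_Suc_iff) (simp del: power_Suc)
  qed
  moreover have "(\<Sum>k<K. (q ^ Suc k) ^ Suc m / of_nat (Suc m)) =
      (q ^ Suc m - q ^ Suc m * (q ^ Suc m) ^ K) / (of_nat (Suc m) * (1 - q ^ Suc m))" for m
  proof -
    define z where "z = q ^ Suc m"
    have z: "1 - z \<noteq> 0" using ne[of m] by (simp add: z_def)
    have "(q ^ Suc k) ^ Suc m = z * z ^ k" for k
      unfolding z_def power_mult[symmetric] power_add[symmetric] mult_Suc_right[symmetric]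
      by (simp only: mult.commute)
    hence "(\<Sum>k<K. (q ^ Suc k) ^ Suc m / of_nat (Suc m)) = (\<Sum>k<K. z * z ^ k) / of_nat (Suc m)"
      by (simp only: sum_divide_distrib)
    also have "(\<Sum>k<K. z * z ^ k) = (z - z * z ^ K) / (1 - z)"
      using z by (simp add: sum_distrib_left[symmetric] sum_gp_strict right_diff_distrib)
    finally show ?thesis by (simp add: z_def mult_ac)
  qed
  ultimately have "(\<lambda>m. (q ^ Suc m - q ^ Suc m * (q ^ Suc m) ^ K) / (of_nat (Suc m) * (1 - q ^ Suc m))) sums w"
    by simp
  from sums_diff[OF this log_euler_sums[OF q]]
  have s: "(\<lambda>m. (- (q ^ Suc m * (q ^ Suc m) ^ K)) / (of_nat (Suc m) * (1 - q ^ Suc m))) sums (w - log_euler q)"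
    by (simp add: diff_divide_distrib[symmetric] del: power_Suc)
  have g: "(\<lambda>m. norm q ^ K * (norm q ^ Suc m / (1 - norm q))) sums (norm q ^ K * (norm q / (1 - norm q)\<^sup>2))"
    using q by (intro sums_mult geometric_sums_Suc) auto
  have "norm (w - log_euler q) \<le> norm q ^ K * (norm q / (1 - norm q)\<^sup>2)"
  proof (rule norm_sums_le[OF s g])
    fix m
    have "norm ((- (q ^ Suc m * (q ^ Suc m) ^ K)) / (of_nat (Suc m) * (1 - q ^ Suc m)))
        \<le> norm (- (q ^ Suc m * (q ^ Suc m) ^ K)) / (1 - norm q)"
      by (rule log_euler_term_bound[OF q])
    also have "norm (- (q ^ Suc m * (q ^ Suc m) ^ K)) = norm q ^ Suc m * norm q ^ (Suc m * K)"
      by (simp only: norm_minus_cancel norm_mult norm_power power_mult)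
    also have "\<dots> \<le> norm q ^ Suc m * norm q ^ K"
      using q by (intro mult_left_mono power_decreasing) auto
    finally show "norm ((- (q ^ Suc m * (q ^ Suc m) ^ K)) / (of_nat (Suc m) * (1 - q ^ Suc m)))
        \<le> norm q ^ K * (norm q ^ Suc m / (1 - norm q))"
      using q by (simp add: divide_right_mono mult.commute)
  qed
  thus "norm (w - log_euler q) \<le> norm q ^ Suc K / (1 - norm q)\<^sup>2"
    by (simp add: mult.commute)
qed

section \<open>The inversion formula in the right half plane\<close>

lemma bose_sum_tendsto:
  assumes a: "a > 0"
  shows "\<exists>S. bose_sum a \<longlonglongrightarrow> S \<and> complex_of_real S = log_euler (exp (- of_real (2 * pi * a)))"
proof -
  define q where "q = exp (- (2 * pi * a))"
  have q: "0 < q" "q < 1" using a by (auto simp: q_def)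
  have cq: "exp (- of_real (2 * pi * a)) = complex_of_real q"
    by (simp add: q_def flip: exp_of_real)
  have trm: "complex_of_real q ^ Suc m / (of_nat (Suc m) * (1 - complex_of_real q ^ Suc m))
      = of_real (1 / (real (Suc m) * (exp (2 * pi * a * real (Suc m)) - 1)))" for m
  proof -
    have e: "q ^ Suc m = exp (- (2 * pi * a * real (Suc m)))"
      unfolding q_def exp_of_nat_mult[symmetric]
      by (rule arg_cong[where f = exp]) (simp add: algebra_simps)
    define E where "E = exp (2 * pi * a * real (Suc m))"
    have E: "E > 1" using a by (auto simp: E_def)
    have "q ^ Suc m / (real (Suc m) * (1 - q ^ Suc m)) = 1 / (real (Suc m) * (E - 1))"
      unfolding e exp_minus E_def[symmetric] using E by (simp add: field_simps)
    hence "complex_of_real (q ^ Suc m / (real (Suc m) * (1 - q ^ Suc m)))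
      = of_real (1 / (real (Suc m) * (E - 1)))" by simp
    thus ?thesis unfolding E_def by simp
  qed
  have "(\<lambda>m. complex_of_real q ^ Suc m / (of_nat (Suc m) * (1 - complex_of_real q ^ Suc m))) sums log_euler (of_real q)"
    by (rule log_euler_sums) (use q in auto)
  hence lim: "(\<lambda>M. complex_of_real (bose_sum a M)) \<longlonglongrightarrow> log_euler (of_real q)"
    unfolding trm sums_def bose_sum_def by (simp add: sum.atLeast1_atMost_eq)
  have "bose_sum a \<longlonglongrightarrow> Re (log_euler (of_real q))"
    using tendsto_Re[OF lim] by simp
  moreover from tendsto_of_real[OF this] have "complex_of_real (Re (log_euler (of_real q))) = log_euler (of_real q)"
    by (rule LIMSEQ_unique[OF _ lim])
  ultimately show ?thesis unfolding cq by blast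
qed

text \<open>
  The transformation of the Dedekind eta function under \<open>\<tau> \<mapsto> - 1 / \<tau>\<close>, in logarithmic form
  with \<open>a = - \<i> \<tau>\<close>. Both sides are holomorphic in \<open>Re a > 0\<close> and agree at positive rational
  \<open>a\<close>.
\<close>

theorem log_euler_inversion:
  assumes "Re a > 0"
  shows "log_euler (exp (- (2 * of_real pi * a))) - log_euler (exp (- (2 * of_real pi / a)))
           = of_real pi / (12 * a) - of_real pi * a / 12 + Ln a / 2"
proof -
  let ?S = "{a. Re a > 0}"
  define D where "D = (\<lambda>a. log_euler (exp (- (2 * of_real pi * a))) - log_euler (exp (- (2 * of_real pi / a)))
           - (of_real pi / (12 * a) - of_real pi * a / 12 + Ln a / 2))"
  \<comment> \<open>Positive rational points accumulating at \<open>1\<close>.\<close>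
  define u where "u = (\<lambda>n. of_real (real (n + 2) / real (n + 1)) :: complex)"
  have pos: "Re (2 * of_real pi * a) > 0" "Re (2 * of_real pi / a) > 0" "a \<noteq> 0" if "Re a > 0" for a
    using that by (auto simp: Re_divide intro!: divide_pos_pos add_pos_nonneg)
  have h1: "(\<lambda>a. log_euler (exp (- (2 * of_real pi * a)))) holomorphic_on ?S"
    by (rule holomorphic_on_compose_gen[OF _ holomorphic_log_euler, unfolded o_def])
       (use pos in \<open>auto intro!: holomorphic_intros\<close>)
  have h2: "(\<lambda>a. log_euler (exp (- (2 * of_real pi / a)))) holomorphic_on ?S"
    by (rule holomorphic_on_compose_gen[OF _ holomorphic_log_euler, unfolded o_def])
       (use pos in \<open>auto intro!: holomorphic_intros simp del: Re_divide\<close>)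
  have "D a = 0"
  proof (rule analytic_continuation[of D ?S "range u" 1 a])
    show "D holomorphic_on ?S"
      unfolding D_def using pos(3)
      by (intro holomorphic_intros h1 h2) (auto simp: complex_nonpos_Reals_iff)
    show "open ?S" by (rule open_halfspace_Re_gt)
    show "connected ?S" by (intro convex_connected convex_halfspace_Re_gt)
    show "range u \<subseteq> ?S" by (auto simp: u_def)
    show "1 islimpt range u"
      unfolding islimpt_sequential
    proof (intro exI[of _ u] conjI allI)
      show "u n \<in> range u - {1}" for n
        by (auto simp: u_def field_simps simp flip: of_nat_add)
      have "(\<lambda>n. real (n + 2) / real (n + 1)) \<longlonglongrightarrow> 1" by real_asymp
      hence "(\<lambda>n. complex_of_real (real (n + 2) / real (n + 1))) \<longlonglongrightarrow> of_real 1" by (rule tendsto_of_real)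
      thus "u \<longlonglongrightarrow> 1" by (simp only: u_def of_real_1)
    qed
    show "D z = 0" if "z \<in> range u" for z
    proof -
      from that obtain n where n: "z = u n" by auto
      define b where "b = real (n + 2) / real (n + 1)"
      have b: "b > 0" by (simp add: b_def)
      have zb: "z = of_real b" by (simp add: n u_def b_def)
      obtain S where S: "bose_sum b \<longlonglongrightarrow> S" "complex_of_real S = log_euler (exp (- of_real (2 * pi * b)))"
        using bose_sum_tendsto[OF b] by blast
      obtain S' where S': "bose_sum (1 / b) \<longlonglongrightarrow> S'" "complex_of_real S' = log_euler (exp (- of_real (2 * pi * (1 / b))))"
        using bose_sum_tendsto[of "1 / b"] b by auto
      have "S - S' = pi / (12 * b) - pi * b / 12 + ln b / 2"
        using bose_sum_inversion_rational[of "n + 2" "n + 1" S S', folded b_def] S S' by simp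
      hence "complex_of_real S - complex_of_real S' = of_real (pi / (12 * b) - pi * b / 12 + ln b / 2)"
        by (metis of_real_diff)
      thus ?thesis
        unfolding S(2) S'(2) D_def zb using b by (simp add: Ln_of_real)
    qed
  qed (use assms in auto)
  thus ?thesis by (simp add: D_def)
qed


section \<open>The generating function as an analytic function\<close>

definition cubic_gf_fun :: "complex \<Rightarrow> complex" where
  "cubic_gf_fun q = exp (log_euler q + log_euler (q\<^sup>2))"

lemma holomorphic_cubic_gf_fun: "cubic_gf_fun holomorphic_on ball 0 1"
proof -
  have "norm (q\<^sup>2) < 1" if "norm q < 1" for q :: complex
    using that by (simp add: norm_power abs_square_less_1)
  hence "(\<lambda>q. log_euler (q\<^sup>2)) holomorphic_on ball 0 1"
    by (intro holomorphic_on_compose_gen[OF _ holomorphic_log_euler, unfolded o_def] holomorphic_intros)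
       auto
  thus ?thesis unfolding cubic_gf_fun_def[abs_def]
    by (intro holomorphic_intros holomorphic_log_euler)
qed

definition fps_complexify :: "real fps \<Rightarrow> complex fps" where
  "fps_complexify f = Abs_fps (\<lambda>n. of_real (fps_nth f n))"

lemma fps_complexify_mult: "fps_complexify (f * g) = fps_complexify f * fps_complexify g"
  by (rule fps_ext) (simp add: fps_complexify_def fps_mult_nth)

lemma fps_complexify_1: "fps_complexify 1 = 1"
  by (rule fps_ext) (simp add: fps_complexify_def)

lemma fps_complexify_prod: "fps_complexify (\<Prod>k\<in>A. f k) = (\<Prod>k\<in>A. fps_complexify (f k))"
  by (induction A rule: infinite_finite_induct) (simp_all add: fps_complexify_mult fps_complexify_1)

lemma fps_complexify_factor:
  "fps_complexify (cubic_partition_factor k) =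
     inverse ((1 - fps_X ^ (k + 1)) * (1 - fps_X ^ (2 * (k + 1))))"
proof -
  define D :: "real fps" where "D = (1 - fps_X ^ (k + 1)) * (1 - fps_X ^ (2 * (k + 1)))"
  define E :: "complex fps" where "E = (1 - fps_X ^ (k + 1)) * (1 - fps_X ^ (2 * (k + 1)))"
  have *: "fps_complexify (1 - fps_X ^ j) = 1 - fps_X ^ j" for j
    by (rule fps_ext) (simp add: fps_complexify_def fps_X_power_nth)
  have DE: "fps_complexify D = E" by (simp only: D_def E_def fps_complexify_mult *)
  have "fps_nth D 0 = 1" by (simp add: D_def)
  hence "cubic_partition_factor k * D = 1"
    unfolding cubic_partition_factor_def D_def[symmetric]
    using inverse_mult_eq_1[of D] by (simp add: fps_divide_unit)
  hence "fps_complexify (cubic_partition_factor k) * E = 1"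
    by (metis DE fps_complexify_mult fps_complexify_1)
  moreover have "fps_nth E 0 \<noteq> 0" by (simp add: E_def)
  ultimately show ?thesis unfolding E_def[symmetric]
    by (metis fps_inverse_unique mult.commute)
qed

text \<open>
  The finite products converge to the power series coefficientwise and to the function uniformly near
  the origin. Together these identify the power series as the expansion of the function.
\<close>

lemma cubic_gf_fun_has_fps_expansion:
  "cubic_gf_fun has_fps_expansion fps_complexify cubic_partition_gf"
proof -
  let ?A = "ball 0 (1/2) :: complex set"
  define f where "f = (\<lambda>N (z::complex). \<Prod>k\<le>N. inverse ((1 - z ^ (k + 1)) * (1 - z ^ (2 * (k + 1)))))"
  define C where "C = (\<lambda>N. \<Prod>k\<le>N. cubic_partition_factor k)"
  define L where "L = (\<lambda>q. log_euler q + log_euler (q\<^sup>2))"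
  have pw: "norm (z ^ k) < 1" if "z \<in> ?A" "k > 0" for z k
  proof -
    have "norm z ^ k \<le> norm z ^ 1" using that by (intro power_decreasing) auto
    with that show ?thesis by (simp add: norm_power)
  qed
  have nz: "1 - z ^ k \<noteq> 0" if "z \<in> ?A" "k > 0" for z k
    using pw[OF that] by auto
  have W: "\<exists>w. f N z = exp w \<and> norm (w - L z) \<le> 8 * (1 / 2) ^ (N + 2)" if z: "z \<in> ?A" for z N
  proof -
    have n1: "norm z < 1" "norm z \<le> 1 / 2" using z by auto
    have n2: "norm (z\<^sup>2) < 1" "norm (z\<^sup>2) \<le> 1 / 2"
    proof -
      have "norm z ^ 2 \<le> norm z ^ 1" using n1 by (intro power_decreasing) auto
      thus "norm (z\<^sup>2) < 1" "norm (z\<^sup>2) \<le> 1 / 2" using n1 by (auto simp: norm_power)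
    qed
    obtain w1 where w1: "(\<Prod>k<Suc N. 1 / (1 - z ^ Suc k)) = exp w1"
       "norm (w1 - log_euler z) \<le> norm z ^ Suc (Suc N) / (1 - norm z)\<^sup>2"
      using euler_partial_product[OF n1(1)] by blast
    obtain w2 where w2: "(\<Prod>k<Suc N. 1 / (1 - (z\<^sup>2) ^ Suc k)) = exp w2"
       "norm (w2 - log_euler (z\<^sup>2)) \<le> norm (z\<^sup>2) ^ Suc (Suc N) / (1 - norm (z\<^sup>2))\<^sup>2"
      using euler_partial_product[OF n2(1)] by blast
    have b: "r ^ Suc (Suc N) / (1 - r)\<^sup>2 \<le> 4 * (1 / 2) ^ (N + 2)" if "0 \<le> r" "r \<le> 1 / 2" for r :: real
    proof -
      have "r ^ Suc (Suc N) / (1 - r)\<^sup>2 \<le> (1 / 2) ^ Suc (Suc N) / (1 / 2)\<^sup>2"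
        using that by (intro frac_le power_mono) auto
      thus ?thesis by (simp add: power2_eq_square)
    qed
    have "norm (w1 + w2 - L z) \<le> norm (w1 - log_euler z) + norm (w2 - log_euler (z\<^sup>2))"
      using norm_triangle_ineq[of "w1 - log_euler z" "w2 - log_euler (z\<^sup>2)"] by (simp add: L_def algebra_simps)
    also have "\<dots> \<le> 4 * (1 / 2) ^ (N + 2) + 4 * (1 / 2) ^ (N + 2)"
      by (intro add_mono order.trans[OF w1(2) b] order.trans[OF w2(2) b]) (use n1 n2 in auto)
    finally have "norm (w1 + w2 - L z) \<le> 8 * (1 / 2) ^ (N + 2)" by simp
    moreover have "f N z = exp (w1 + w2)"
      unfolding exp_add w1(1)[symmetric] w2(1)[symmetric] f_def prod.distrib[symmetric] lessThan_Suc_atMost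
      by (intro prod.cong refl) (simp only: inverse_eq_divide times_divide_times_eq mult_1 Suc_eq_plus1 power_mult)
    ultimately show ?thesis by blast
  qed
  \<comment> \<open>The logarithm of the finite product depends on the point, so it has to be chosen for every point.\<close>
  define W where "W = (\<lambda>N z. SOME w. f N z = exp w \<and> norm (w - L z) \<le> 8 * (1 / 2) ^ (N + 2))"
  have W: "f N z = exp (W N z)" "norm (W N z - L z) \<le> 8 * (1 / 2) ^ (N + 2)" if "z \<in> ?A" for z N
    using someI_ex[OF W[OF that, of N]] unfolding W_def by auto
  have Lb: "norm (L z) \<le> 4" if z: "z \<in> ?A" for z
  proof -
    have b: "norm (log_euler y) \<le> 2" if "norm y \<le> 1 / 2" for y
    proof -
      have "norm (log_euler y) \<le> norm y / (1 - norm y)\<^sup>2"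
        using that by (intro norm_log_euler_le) auto
      also have "\<dots> \<le> (1 / 2) / (1 / 2)\<^sup>2"
        using that by (intro frac_le power_mono) auto
      finally show ?thesis by (simp add: power2_eq_square)
    qed
    have "norm z ^ 2 \<le> norm z ^ 1" using z by (intro power_decreasing) auto
    hence "norm (log_euler z) \<le> 2" "norm (log_euler (z\<^sup>2)) \<le> 2"
      using z by (auto intro!: b simp: norm_power)
    thus ?thesis unfolding L_def using norm_triangle_ineq[of "log_euler z" "log_euler (z\<^sup>2)"] by linarith
  qed
  have "uniform_limit ?A W L sequentially"
  proof (rule uniform_limitI)
    fix e :: real assume e: "e > 0"
    have "(\<lambda>N. 8 * (1 / 2) ^ (N + 2) :: real) \<longlonglongrightarrow> 0" by real_asymp
    hence "\<forall>\<^sub>F N in sequentially. 8 * (1 / 2) ^ (N + 2) < e"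
      using e by (rule order_tendstoD)
    thus "\<forall>\<^sub>F N in sequentially. \<forall>x\<in>?A. dist (W N x) (L x) < e"
    proof eventually_elim
      case (elim N)
      show ?case
      proof
        fix x assume "x \<in> ?A"
        from le_less_trans[OF W(2)[OF this] elim] show "dist (W N x) (L x) < e"
          by (simp only: dist_norm)
      qed
    qed
  qed
  \<comment> \<open>Since \<open>\<bar>L\<bar> \<le> 4\<close> and the logarithms differ from \<open>L\<close> by at most \<open>2\<close>, the
    exponential is only needed on a fixed disc.\<close>
  moreover have "uniformly_continuous_on (cball 0 6) (exp :: complex \<Rightarrow> complex)"
    by (intro compact_uniformly_continuous continuous_intros) auto
  moreover have "\<forall>\<^sub>F N in sequentially. W N ` ?A \<subseteq> cball 0 6"
  proof (intro always_eventually allI subsetI)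
    fix N w assume "w \<in> W N ` ?A"
    then obtain z where z: "z \<in> ?A" "w = W N z" by auto
    have "norm w \<le> norm (W N z - L z) + norm (L z)"
      unfolding z(2) using norm_triangle_sub[of "W N z" "L z"] by simp
    also have "\<dots> \<le> 8 * (1 / 2) ^ (N + 2) + 4"
      by (intro add_mono W Lb z)
    also have "(1 / 2) ^ (N + 2) \<le> (1 / 2 :: real) ^ 2" by (intro power_decreasing) auto
    finally show "w \<in> cball 0 6" by (simp add: power2_eq_square)
  qed
  ultimately have "uniform_limit ?A (\<lambda>N z. exp (W N z)) (exp \<circ> L) sequentially"
    by (rule uniform_limit_compose) (use Lb in force)
  hence lim: "uniform_limit ?A f cubic_gf_fun sequentially"
    by (subst uniform_limit_cong'[where g = "\<lambda>N z. exp (W N z)" and i = "exp \<circ> L"])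
       (use W(1) in \<open>auto simp: cubic_gf_fun_def L_def\<close>)
  have hol: "f N holomorphic_on ?A" for N
    unfolding f_def using nz by (intro holomorphic_intros) (auto simp del: power_Suc simp flip: Suc_eq_plus1)
  have exps: "f N has_fps_expansion fps_complexify (C N)" for N
    unfolding f_def C_def fps_complexify_prod fps_complexify_factor
    by (intro fps_expansion_intros) auto
  have "C \<longlonglongrightarrow> cubic_partition_gf"
    using has_prod_imp_tendsto[OF has_prod_cubic_partition_gf] by (simp add: C_def)
  hence climit: "(\<lambda>N. fps_complexify (C N)) \<longlonglongrightarrow> fps_complexify cubic_partition_gf"
    unfolding tendsto_fps_iff fps_complexify_def by (auto elim!: eventually_mono)
  have F: "cubic_gf_fun has_fps_expansion fps_expansion cubic_gf_fun 0"
    by (rule has_fps_expansion_fps_expansion[of "ball 0 1"]) (auto intro: holomorphic_cubic_gf_fun)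
  have "fps_expansion cubic_gf_fun 0 = fps_complexify cubic_partition_gf"
    by (rule uniform_limit_imp_fps_expansion_eq[OF climit lim _ F])
       (use exps hol in auto)
  with F show ?thesis by simp
qed

lemma cubic_partition_contour:
  assumes r: "0 < r" "r < 1"
  shows "((\<lambda>u. cubic_gf_fun u / u ^ Suc n) has_contour_integral 2 * pi * \<i> * of_real (cubic_partition n)) (circlepath 0 r)"
proof -
  have h: "cubic_gf_fun holomorphic_on cball 0 r"
    using r by (intro holomorphic_on_subset[OF holomorphic_cubic_gf_fun]) auto
  have "((\<lambda>u. cubic_gf_fun u / (u - 0) ^ Suc n) has_contour_integral
       (2 * pi * \<i> / fact n * (deriv ^^ n) cubic_gf_fun 0)) (circlepath 0 r)"
    by (rule Cauchy_has_contour_integral_higher_derivative_circlepath)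
       (use h r in \<open>auto intro: holomorphic_on_imp_continuous_on holomorphic_on_subset[OF h]\<close>)
  moreover have "(deriv ^^ n) cubic_gf_fun 0 / fact n = of_real (cubic_partition n)"
    using fps_nth_fps_expansion[OF cubic_gf_fun_has_fps_expansion, of n]
    by (simp add: fps_complexify_def cubic_partition_def)
  ultimately show ?thesis by (simp add: field_simps del: power_Suc)
qed

text \<open>
  Cauchy's formula for the coefficient, in the variable \<open>t = - log q\<close>. It is stated through a
  primitive of the integrand, so that every later change of the path of integration is a telescoping
  of differences of \<open>\<Phi>\<close>. By periodicity of the integrand the increment of \<open>\<Phi>\<close> over
  \<open>2 \<pi> \<i>\<close> is a constant, and the circle \<open>\<bar>q\<bar> = exp (- 1)\<close> gives its value.
\<close>

lemma cubic_partition_primitive: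
  obtains \<Phi> where
    "\<And>t. Re t > 0 \<Longrightarrow> (\<Phi> has_field_derivative cubic_gf_fun (exp (- t)) * exp (of_nat n * t)) (at t)"
    "\<And>x. x > 0 \<Longrightarrow> \<Phi> (Complex x pi) - \<Phi> (Complex x (- pi)) = 2 * pi * \<i> * of_real (cubic_partition n)"
proof -
  let ?S = "{t. Re t > 0}"
  define G where "G = (\<lambda>t. cubic_gf_fun (exp (- t)) * exp (of_nat n * t))"
  have opn: "open ?S" by (rule open_halfspace_Re_gt)
  have cvx: "convex ?S" by (rule convex_halfspace_Re_gt)
  have "(\<lambda>t. cubic_gf_fun (exp (- t))) holomorphic_on ?S"
    by (rule holomorphic_on_compose_gen[OF _ holomorphic_cubic_gf_fun, unfolded o_def])
       (auto intro!: holomorphic_intros)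
  hence "G holomorphic_on ?S" unfolding G_def by (intro holomorphic_intros)
  then obtain \<Phi> where "\<And>t. t \<in> ?S \<Longrightarrow> (\<Phi> has_field_derivative G t) (at t within ?S)"
    using holomorphic_convex_primitive'[OF cvx opn] by blast
  hence \<Phi>: "(\<Phi> has_field_derivative G t) (at t)" if "Re t > 0" for t
    using at_within_open[OF _ opn, of t] that by fastforce
  have per: "G (t - 2 * of_real pi * \<i>) = G t" for t
  proof -
    have "exp (- (t - 2 * of_real pi * \<i>)) = exp (- t)"
      unfolding exp_eq by (intro exI[of _ 1]) (simp add: algebra_simps)
    moreover have "exp (of_nat n * (t - 2 * of_real pi * \<i>)) = exp (of_nat n * t)"
      unfolding exp_eq by (intro exI[of _ "- int n"]) (simp add: algebra_simps)
    ultimately show ?thesis by (simp add: G_def)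
  qed
  have "\<exists>c. \<forall>t\<in>?S. \<Phi> t - \<Phi> (t - 2 * of_real pi * \<i>) = c"
  proof (rule has_field_derivative_zero_constant[OF cvx])
    fix t assume "t \<in> ?S"
    hence t: "Re t > 0" "Re (t - 2 * of_real pi * \<i>) > 0" by auto
    have "((\<lambda>t. \<Phi> t - \<Phi> (t - 2 * of_real pi * \<i>)) has_field_derivative G t - G (t - 2 * of_real pi * \<i>) * 1) (at t)"
      by (intro DERIV_diff \<Phi> t DERIV_chain2[where f = \<Phi> and g = "\<lambda>t. t - 2 * of_real pi * \<i>"]) (auto intro!: derivative_eq_intros)
    thus "((\<lambda>t. \<Phi> t - \<Phi> (t - 2 * of_real pi * \<i>)) has_field_derivative 0) (at t within ?S)"
      by (simp add: per has_field_derivative_at_within)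
  qed
  then obtain c where c: "\<And>t. Re t > 0 \<Longrightarrow> \<Phi> t - \<Phi> (t - 2 * of_real pi * \<i>) = c"
    by auto
  have cval: "c = 2 * pi * \<i> * of_real (cubic_partition n)"
  proof -
    define r where "r = exp (-1 :: real)"
    have r: "0 < r" "r < 1" by (auto simp: r_def)
    have e: "of_real r * cis \<theta> = exp (- (1 - \<i> * of_real \<theta>))" for \<theta>
      by (simp add: r_def cis_conv_exp exp_diff exp_minus exp_of_real[symmetric] field_simps)
    have ep: "(exp (- t)) ^ n * exp (of_nat n * t) = 1" for t :: complex
      by (simp add: exp_of_nat_mult[symmetric] exp_add[symmetric])
    have "((\<lambda>\<theta>. cubic_gf_fun (0 + of_real r * cis \<theta>) / (0 + of_real r * cis \<theta>) ^ Suc n * of_real r * \<i> * cis \<theta>)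
         has_integral (2 * pi * \<i> * of_real (cubic_partition n))) {0..2 * pi}"
      using cubic_partition_contour[OF r, of n] has_contour_integral_part_circlepath_iff[of 0 "2 * pi"]
      by (simp add: circlepath_def)
    also have "(\<lambda>\<theta>. cubic_gf_fun (0 + of_real r * cis \<theta>) / (0 + of_real r * cis \<theta>) ^ Suc n * of_real r * \<i> * cis \<theta>)
        = (\<lambda>\<theta>. \<i> * G (1 - \<i> * of_real \<theta>))"
    proof
      fix \<theta> :: real
      define t where "t = 1 - \<i> * of_real \<theta>"
      have "cubic_gf_fun (0 + of_real r * cis \<theta>) / (0 + of_real r * cis \<theta>) ^ Suc n * of_real r * \<i> * cis \<theta>
         = \<i> * (cubic_gf_fun (of_real r * cis \<theta>) / (of_real r * cis \<theta>) ^ n)"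
        using r by (simp add: field_simps)
      also have "\<dots> = \<i> * (cubic_gf_fun (exp (- t)) / (exp (- t)) ^ n)"
        by (simp only: e t_def)
      also have "\<dots> = \<i> * G t"
        using ep[of t] by (simp add: G_def field_simps)
      finally show "cubic_gf_fun (0 + of_real r * cis \<theta>) / (0 + of_real r * cis \<theta>) ^ Suc n * of_real r * \<i> * cis \<theta>
         = \<i> * G (1 - \<i> * of_real \<theta>)" by (simp add: t_def)
    qed
    finally have 1: "((\<lambda>\<theta>. \<i> * G (1 - \<i> * of_real \<theta>)) has_integral (2 * pi * \<i> * of_real (cubic_partition n))) {0..2 * pi}" .
    have "((\<lambda>\<theta>. \<i> * G (1 - \<i> * of_real \<theta>)) has_integral
        (- \<Phi> (1 - \<i> * of_real (2 * pi)) - - \<Phi> (1 - \<i> * of_real 0))) {0..2 * pi}"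
    proof (rule fundamental_theorem_of_calculus)
      fix \<theta> :: real
      have "((\<lambda>z. - \<Phi> (1 - \<i> * z)) has_field_derivative (- (G (1 - \<i> * of_real \<theta>) * (- \<i>)))) (at (of_real \<theta>))"
        by (intro DERIV_minus DERIV_chain2[OF \<Phi>]) (auto intro!: derivative_eq_intros)
      from has_vector_derivative_real_field[OF this]
      show "((\<lambda>\<theta>. - \<Phi> (1 - \<i> * of_real \<theta>)) has_vector_derivative \<i> * G (1 - \<i> * of_real \<theta>)) (at \<theta> within {0..2 * pi})"
        by (simp add: mult.commute)
    qed auto
    from has_integral_unique[OF this 1] c[of 1] show ?thesis by (simp add: mult_ac)
  qed
  show ?thesis
  proof (rule that[of \<Phi>])
    fix x :: real assume x: "x > 0"
    have "Complex x pi - 2 * of_real pi * \<i> = Complex x (- pi)" by (simp add: complex_eq_iff)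
    with c[of "Complex x pi"] x cval show "\<Phi> (Complex x pi) - \<Phi> (Complex x (- pi)) = 2 * pi * \<i> * of_real (cubic_partition n)"
      by simp
  qed (use \<Phi> in \<open>simp add: G_def\<close>)
qed

section \<open>Size of the generating function\<close>

text \<open>
  The logarithm of \<open>P(q\<^sub>1) P(q\<^sub>2)\<close> at the points \<open>q\<^sub>1\<close>, \<open>q\<^sub>2\<close> that the inversion formula
  associates with \<open>exp (- t)\<close> and \<open>exp (- 2 t)\<close>.
\<close>

definition dual_log :: "complex \<Rightarrow> complex" where
  "dual_log t = log_euler (exp (- (4 * (of_real pi)\<^sup>2 / t))) + log_euler (exp (- (2 * (of_real pi)\<^sup>2 / t)))"

text \<open>
  The inversion formula at \<open>a = t / (2 \<pi>)\<close> and at \<open>b = t / \<pi>\<close>. The two logarithmic terms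
  combine to \<open>exp ((Ln a + Ln b) / 2) = t / (sqrt 2 \<pi>)\<close>.
\<close>

theorem cubic_gf_fun_modular:
  assumes t: "Re t > 0"
  shows "cubic_gf_fun (exp (- t)) =
     t / of_real (sqrt 2 * pi) * exp ((of_real pi)\<^sup>2 / (4 * t) - t / 8) * exp (dual_log t)"
proof -
  have t0: "t \<noteq> 0" using t by auto
  have pi0: "complex_of_real pi \<noteq> 0" by simp
  define a where "a = t / (2 * of_real pi)"
  define b where "b = t / of_real pi"
  have ae: "a = of_real (1 / (2 * pi)) * t" and be: "b = of_real (1 / pi) * t"
    by (simp_all add: a_def b_def)
  have ab: "Re a > 0" "Re b > 0"
    unfolding ae be times_complex.sel Re_complex_of_real Im_complex_of_real using t by simp_all
  have La: "Ln a = Ln t - of_real (ln (2 * pi))"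
    using Ln_divide_of_real[of "2 * pi" t] t0 by (simp add: a_def)
  have Lb: "Ln b = Ln t - of_real (ln pi)"
    using Ln_divide_of_real[of pi t] t0 by (simp add: b_def)
  have s1: "log_euler (exp (- t)) = log_euler (exp (- (4 * (of_real pi)\<^sup>2 / t)))
       + (of_real pi / (12 * a) - of_real pi * a / 12 + Ln a / 2)"
  proof -
    have *: "2 * of_real pi * a = t" "2 * of_real pi / a = 4 * (of_real pi)\<^sup>2 / t"
      using pi0 t0 by (auto simp: a_def power2_eq_square field_simps)
    show ?thesis using log_euler_inversion[OF ab(1)] unfolding * by (simp only: diff_eq_eq add.commute)
  qed
  have s2: "log_euler ((exp (- t))\<^sup>2) = log_euler (exp (- (2 * (of_real pi)\<^sup>2 / t)))
       + (of_real pi / (12 * b) - of_real pi * b / 12 + Ln b / 2)"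
  proof -
    have *: "2 * of_real pi * b = 2 * t" "2 * of_real pi / b = 2 * (of_real pi)\<^sup>2 / t"
      using pi0 t0 by (auto simp: b_def power2_eq_square field_simps)
    have sq: "(exp (- t))\<^sup>2 = exp (- (2 * t))"
      by (simp add: power2_eq_square flip: exp_add)
    show ?thesis using log_euler_inversion[OF ab(2)] unfolding * sq by (simp only: diff_eq_eq add.commute)
  qed
  have p1: "of_real pi / (12 * a) + of_real pi / (12 * b) = (of_real pi)\<^sup>2 / (4 * t)"
    using pi0 t0 by (simp add: a_def b_def power2_eq_square field_simps)
  have p2: "of_real pi * a / 12 + of_real pi * b / 12 = t / 8"
    using pi0 by (simp add: a_def b_def field_simps)
  define c where "c = (ln (2 * pi) + ln pi) / 2"
  have c: "exp c = sqrt 2 * pi"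
  proof -
    have "(exp c)\<^sup>2 = exp (ln (2 * pi) + ln pi)"
      by (simp add: c_def power2_eq_square flip: exp_add)
    also have "\<dots> = (sqrt 2 * pi)\<^sup>2"
      by (simp add: exp_add power_mult_distrib power2_eq_square)
    finally show ?thesis by (simp add: power2_eq_iff_nonneg)
  qed
  have p3: "Ln a / 2 + Ln b / 2 = Ln t - of_real c"
    unfolding La Lb c_def by (simp add: field_simps)
  have "log_euler (exp (- t)) + log_euler ((exp (- t))\<^sup>2) =
      dual_log t + (of_real pi / (12 * a) + of_real pi / (12 * b)) - (of_real pi * a / 12 + of_real pi * b / 12)
      + (Ln a / 2 + Ln b / 2)"
    unfolding s1 s2 dual_log_def by (simp add: algebra_simps)
  also have "\<dots> = Ln t - of_real c + ((of_real pi)\<^sup>2 / (4 * t) - t / 8) + dual_log t"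
    unfolding p1 p2 p3 by (simp add: algebra_simps)
  finally have eq: "log_euler (exp (- t)) + log_euler ((exp (- t))\<^sup>2) =
      Ln t - of_real c + ((of_real pi)\<^sup>2 / (4 * t) - t / 8) + dual_log t" .
  have "exp (Ln t - of_real c) = t / of_real (sqrt 2 * pi)"
    unfolding exp_diff exp_of_real c using t0 by simp
  thus ?thesis unfolding cubic_gf_fun_def eq by (simp only: exp_add)
qed

text \<open>
  In the sector \<open>Re t \<ge> 4 / 5 * \<bar>t\<bar>\<close> the dual points have modulus at most
  \<open>exp (- 2 \<pi>\<^sup>2 Re (1 / t))\<close> with \<open>Re (1 / t) \<ge> 4 / (5 \<rho>)\<close>, and
  \<open>8 \<pi>\<^sup>2 / 5 > 15\<close>.
\<close>

lemma norm_dual_log_le: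
  assumes "norm t = \<rho>" "Re t \<ge> 4 / 5 * \<rho>" "0 < \<rho>" "\<rho> \<le> 1"
  shows "norm (dual_log t) \<le> 8 * exp (- 15 / \<rho>)"
proof -
  define e where "e = exp (- 15 / \<rho>)"
  have "Re (1 / t) = Re t / \<rho>\<^sup>2"
    unfolding Re_divide using assms(1) by (simp add: cmod_power2[symmetric])
  also have "\<dots> \<ge> 4 / 5 * \<rho> / \<rho>\<^sup>2" using assms by (intro divide_right_mono) auto
  finally have r: "Re (1 / t) \<ge> 4 / (5 * \<rho>)" using assms(3) by (simp add: power2_eq_square)
  have pi2: "pi\<^sup>2 \<ge> 9.5"
  proof -
    have "(3.1 :: real)\<^sup>2 \<le> pi\<^sup>2" using pi_approx by (intro power_mono) auto
    thus ?thesis by (simp add: power2_eq_square)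
  qed
  have ee: "e \<le> 1 / 2"
  proof -
    have "1 \<le> 15 / \<rho>" using assms by (simp add: field_simps)
    hence "exp (- 15 / \<rho>) \<le> exp (-1)" by simp
    also have "exp (-1 :: real) \<le> 1 / 2" using exp_ge_add_one_self[of 1] by (simp add: exp_minus field_simps)
    finally show ?thesis by (simp add: e_def)
  qed
  have b: "norm (log_euler (exp (- (of_real k * (of_real pi)\<^sup>2 / t)))) \<le> 4 * e" if k: "k \<ge> 2" for k :: real
  proof -
    define q where "q = exp (- (of_real k * (of_real pi)\<^sup>2 / t))"
    have "Re (of_real k * (of_real pi)\<^sup>2 / t) = k * pi\<^sup>2 * Re (1 / t)"
    proof -
      have "of_real k * (of_real pi)\<^sup>2 / t = of_real (k * pi\<^sup>2) * (1 / t)" by simp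
      thus ?thesis by (simp only: times_complex.sel Re_complex_of_real Im_complex_of_real mult_zero_left diff_zero)
    qed
    also have "\<dots> \<ge> (2 * 9.5) * (4 / (5 * \<rho>))"
      using r k pi2 assms(3) by (intro mult_mono) auto
    also have "(2 * 9.5) * (4 / (5 * \<rho>)) \<ge> 15 / \<rho>"
      using assms(3) by (simp add: field_simps)
    finally have "Re (of_real k * (of_real pi)\<^sup>2 / t) \<ge> 15 / \<rho>" by simp
    hence nq: "norm q \<le> e" unfolding q_def e_def by simp
    hence nq2: "norm q \<le> 1 / 2" using ee by simp
    hence "norm (log_euler q) \<le> norm q / (1 - norm q)\<^sup>2"
      by (intro norm_log_euler_le) auto
    also have "\<dots> \<le> e / (1 / 2)\<^sup>2"
      using nq nq2 by (intro frac_le power_mono) (auto simp: e_def)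
    finally show ?thesis by (simp add: q_def power2_eq_square)
  qed
  have "norm (dual_log t) \<le> 4 * e + 4 * e"
    unfolding dual_log_def
    using b[of 4] b[of 2] by (intro norm_triangle_le add_mono) simp_all
  thus ?thesis by (simp add: e_def)
qed

lemma norm_exp_minus_one_le:
  fixes z :: complex
  assumes "norm z \<le> 1"
  shows "norm (exp z - 1) \<le> 3 * norm z"
proof -
  have "norm (exp z - (\<Sum>k\<le>0. z ^ k / fact k)) \<le> exp \<bar>Re z\<bar> * norm z ^ Suc 0 / fact 0"
    by (rule Taylor_exp)
  also have "exp \<bar>Re z\<bar> \<le> exp 1" using abs_Re_le_cmod[of z] assms by simp
  also have "exp (1::real) \<le> 3" by (rule exp_le)
  finally show ?thesis by (simp add: mult_right_mono)
qed

text \<open>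
  Every term of the series at \<open>q\<close> has real part at most the corresponding term at
  \<open>r = \<bar>q\<bar>\<close>. The first inequality also keeps the gain in the term \<open>m = 1\<close>, which is already
  of the full order of magnitude when \<open>q\<close> is away from the positive axis.
\<close>

lemma Re_log_euler_diff_le:
  fixes q :: complex
  assumes q: "norm q < 1"
  defines "r \<equiv> norm q"
  shows "Re (log_euler q) \<le> Re (log_euler (of_real r)) + r / norm (1 - q) - r / (1 - r)"
    and "Re (log_euler q) \<le> Re (log_euler (of_real r))"
proof -
  have r: "0 \<le> r" "r < 1" using q by (auto simp: r_def)
  have pw: "r ^ Suc m < 1" for m
    using power_decreasing[of 1 "Suc m" r] r by simp
  define f where "f = (\<lambda>m. r ^ Suc m / (real (Suc m) * (1 - r ^ Suc m)))"
  have f: "f sums Re (log_euler (of_real r))"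
  proof -
    have "(\<lambda>m. complex_of_real r ^ Suc m / (of_nat (Suc m) * (1 - complex_of_real r ^ Suc m))) sums log_euler (of_real r)"
      by (rule log_euler_sums) (use r in simp)
    also have "(\<lambda>m. complex_of_real r ^ Suc m / (of_nat (Suc m) * (1 - complex_of_real r ^ Suc m))) = (\<lambda>m. of_real (f m))"
      by (simp add: f_def)
    finally show ?thesis using sums_Re by fastforce
  qed
  have g: "(\<lambda>m. Re (q ^ Suc m / (of_nat (Suc m) * (1 - q ^ Suc m)))) sums Re (log_euler q)"
    by (rule sums_Re[OF log_euler_sums[OF q]])
  have t: "Re (q ^ Suc m / (of_nat (Suc m) * (1 - q ^ Suc m))) \<le> r ^ Suc m / (real (Suc m) * norm (1 - q ^ Suc m))" for m
  proof -
    have "Re (q ^ Suc m / (of_nat (Suc m) * (1 - q ^ Suc m))) \<le> norm (q ^ Suc m / (of_nat (Suc m) * (1 - q ^ Suc m)))"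
      by (rule complex_Re_le_cmod)
    thus ?thesis by (simp only: norm_divide norm_mult norm_power norm_of_nat r_def)
  qed
  have t2: "r ^ Suc m / (real (Suc m) * norm (1 - q ^ Suc m)) \<le> f m" for m
  proof -
    have "1 - r ^ Suc m \<le> norm (1 - q ^ Suc m)"
      using norm_triangle_ineq2[of 1 "q ^ Suc m"] by (simp only: norm_power norm_one r_def)
    thus ?thesis unfolding f_def using pw[of m] r
      by (intro divide_left_mono mult_left_mono mult_pos_pos) (auto simp del: power_Suc)
  qed
  show "Re (log_euler q) \<le> Re (log_euler (of_real r))"
    by (rule sums_le[OF _ g f]) (use order.trans[OF t t2] in blast)
  have h: "(\<lambda>m. f m + (if m = 0 then r / norm (1 - q) - r / (1 - r) else 0)) sums
       (Re (log_euler (of_real r)) + (r / norm (1 - q) - r / (1 - r)))"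
    by (intro sums_add f sums_single)
  have "Re (log_euler q) \<le> Re (log_euler (of_real r)) + (r / norm (1 - q) - r / (1 - r))"
  proof (rule sums_le[OF _ g h])
    fix m
    show "Re (q ^ Suc m / (of_nat (Suc m) * (1 - q ^ Suc m))) \<le> f m + (if m = 0 then r / norm (1 - q) - r / (1 - r) else 0)"
    proof (cases "m = 0")
      case True
      thus ?thesis using t[of 0] by (simp add: f_def)
    next
      case False
      thus ?thesis using order.trans[OF t[of m] t2[of m]] by simp
    qed
  qed
  thus "Re (log_euler q) \<le> Re (log_euler (of_real r)) + r / norm (1 - q) - r / (1 - r)" by simp
qed

lemma norm_cubic_gf_fun_le:
  fixes q :: complex
  assumes q: "norm q < 1"
  defines "r \<equiv> norm q"
  shows "norm (cubic_gf_fun q) \<le> norm (cubic_gf_fun (of_real r)) * exp (r / norm (1 - q) - r / (1 - r))"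
proof -
  have q2: "norm (q\<^sup>2) < 1" using q by (simp add: norm_power abs_square_less_1)
  have e: "complex_of_real (norm (q\<^sup>2)) = (of_real r)\<^sup>2" by (simp add: r_def norm_power)
  show ?thesis
    using Re_log_euler_diff_le(1)[OF q] Re_log_euler_diff_le(2)[OF q2] unfolding e
    by (simp add: cubic_gf_fun_def r_def flip: exp_add)
qed

text \<open>
  On a vertical line in the half plane the distance of \<open>q = exp (- t)\<close> from \<open>1\<close> increases with
  \<open>\<bar>y\<bar> \<le> \<pi>\<close>, because
  \<open>\<bar>1 - q\<bar>\<^sup>2 = (1 - r)\<^sup>2 + 2 r (1 - cos y)\<close> with \<open>r = \<bar>q\<bar>\<close>.
\<close>

lemma norm_one_minus_exp_ge:
  assumes y: "y0 \<le> \<bar>y\<bar>" "\<bar>y\<bar> \<le> pi" "0 \<le> y0"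
  shows "norm (1 - exp (- Complex x y)) ^ 2 \<ge> (1 - exp (- x))\<^sup>2 + 2 * exp (- x) * (1 - cos y0)"
proof -
  define r where "r = exp (- x)"
  have "norm (1 - exp (- Complex x y)) ^ 2 = (1 - r * cos y)\<^sup>2 + (r * sin y)\<^sup>2"
    by (simp add: cmod_power2 Re_exp Im_exp r_def)
  also have "\<dots> = 1 - 2 * r * cos y + r\<^sup>2 * ((sin y)\<^sup>2 + (cos y)\<^sup>2)"
    by algebra
  also have "\<dots> = (1 - r)\<^sup>2 + 2 * r * (1 - cos y)"
    unfolding sin_cos_squared_add by (simp add: power2_eq_square algebra_simps)
  finally have e: "norm (1 - exp (- Complex x y)) ^ 2 = (1 - r)\<^sup>2 + 2 * r * (1 - cos y)" .
  have "cos y = cos \<bar>y\<bar>" by (cases "y \<ge> 0") auto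
  also have "\<dots> \<le> cos y0" using y by (intro cos_monotone_0_pi_le) auto
  finally have "(1 - r)\<^sup>2 + 2 * r * (1 - cos y) \<ge> (1 - r)\<^sup>2 + 2 * r * (1 - cos y0)"
    by (intro add_left_mono mult_left_mono) (auto simp: r_def)
  thus ?thesis unfolding e by (simp add: r_def)
qed

text \<open>
  As \<open>\<rho>\<close> tends to \<open>0\<close>, \<open>r / (1 - r)\<close> is asymptotic to \<open>1 / x = 5 / (4 \<rho>)\<close>, while
  \<open>\<bar>1 - q\<bar>\<close> is at least asymptotically \<open>\<rho>\<close>, the modulus of the point
  \<open>4 / 5 * \<rho> + 3 / 5 * \<rho> \<i>\<close> where the vertical line meets the arc. The exponent is therefore
  about \<open>- 1 / (4 \<rho>)\<close> or less; the constant \<open>23 / 100\<close> leaves some room.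
\<close>

lemma minor_arc_exponent:
  "\<forall>\<^sub>F \<rho> in at_right 0. \<forall>y. 3 / 5 * \<rho> \<le> \<bar>y\<bar> \<and> \<bar>y\<bar> \<le> pi \<longrightarrow>
     exp (- (4 / 5 * \<rho>)) / norm (1 - exp (- Complex (4 / 5 * \<rho>) y))
       - exp (- (4 / 5 * \<rho>)) / (1 - exp (- (4 / 5 * \<rho>))) \<le> - (23 / 100) / \<rho>"
proof -
  have 1: "\<forall>\<^sub>F \<rho>::real in at_right 0. exp (- (4 / 5 * \<rho>)) / (1 - exp (- (4 / 5 * \<rho>))) \<ge> 124 / 100 / \<rho>"
    by real_asymp
  have 2: "\<forall>\<^sub>F \<rho>::real in at_right 0. (1 - exp (- (4 / 5 * \<rho>)))\<^sup>2 + 2 * exp (- (4 / 5 * \<rho>)) * (1 - cos (3 / 5 * \<rho>)) \<ge> (100 / 101 * \<rho>)\<^sup>2"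
  proof -
    have "((\<lambda>\<rho>::real. ((1 - exp (- (4 / 5 * \<rho>)))\<^sup>2 + 2 * exp (- (4 / 5 * \<rho>)) * (1 - cos (3 / 5 * \<rho>))) / \<rho>\<^sup>2) \<longlongrightarrow> 1) (at_right 0)"
      by (real_asymp simp add: power2_eq_square)
    moreover have "(100 / 101)\<^sup>2 < (1 :: real)" by (simp add: power2_eq_square)
    ultimately have "\<forall>\<^sub>F \<rho>::real in at_right 0. (100 / 101)\<^sup>2 < ((1 - exp (- (4 / 5 * \<rho>)))\<^sup>2 + 2 * exp (- (4 / 5 * \<rho>)) * (1 - cos (3 / 5 * \<rho>))) / \<rho>\<^sup>2"
      by (rule order_tendstoD)
    moreover have "\<forall>\<^sub>F \<rho>::real in at_right 0. \<rho> > 0" by (rule eventually_at_right_less)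
    ultimately show ?thesis
    proof eventually_elim
      case (elim \<rho>)
      have "(100 / 101 * \<rho>)\<^sup>2 = (100 / 101)\<^sup>2 * \<rho>\<^sup>2" by (rule power_mult_distrib)
      moreover have "\<rho>\<^sup>2 > 0" using elim by simp
      ultimately show ?case using elim(1) by (simp only: pos_less_divide_eq less_imp_le)
    qed
  qed
  have 3: "\<forall>\<^sub>F \<rho>::real in at_right 0. \<rho> > 0" by (rule eventually_at_right_less)
  from 1 2 3 show ?thesis
  proof eventually_elim
    case (elim \<rho>)
    show ?case
    proof (intro allI impI, elim conjE)
      fix y assume y: "3 / 5 * \<rho> \<le> \<bar>y\<bar>" "\<bar>y\<bar> \<le> pi"
      let ?n = "norm (1 - exp (- Complex (4 / 5 * \<rho>) y))"
      have "(100 / 101 * \<rho>)\<^sup>2 \<le> ?n\<^sup>2"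
        using elim(2) norm_one_minus_exp_ge[OF y, of "4 / 5 * \<rho>"] elim(3) by linarith
      hence n: "100 / 101 * \<rho> \<le> ?n" by (rule power2_le_imp_le) auto
      have "exp (- (4 / 5 * \<rho>)) / ?n \<le> 1 / (100 / 101 * \<rho>)"
        using n elim(3) by (intro frac_le) auto
      moreover have "- (23 / 100) / \<rho> = 1 / (100 / 101 * \<rho>) - 124 / 100 / \<rho>"
        using elim(3) by (simp add: field_simps)
      ultimately show "exp (- (4 / 5 * \<rho>)) / ?n - exp (- (4 / 5 * \<rho>)) / (1 - exp (- (4 / 5 * \<rho>))) \<le> - (23 / 100) / \<rho>"
        using elim(1) by (metis diff_mono)
    qed
  qed
qed

section \<open>The Laplace integral\<close>

lemma gaussian_even_moment:
  fixes z :: real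
  assumes z: "z > 0"
  shows "((\<lambda>s. exp (- z * s\<^sup>2 / 2) * s ^ (2 * k)) has_integral
           sqrt (2 * pi / z) * (fact (2 * k) / ((2 * z) ^ k * fact k))) UNIV"
proof -
  define \<sigma> where "\<sigma> = 1 / sqrt z"
  have \<sigma>: "\<sigma> > 0" "\<sigma>\<^sup>2 = 1 / z" using z by (auto simp: \<sigma>_def power_divide)
  have nd: "normal_density 0 \<sigma> s = exp (- z * s\<^sup>2 / 2) / sqrt (2 * pi / z)" for s
    unfolding normal_density_def \<sigma>(2) using z by (simp add: field_simps)
  have m: "has_bochner_integral lborel (\<lambda>s. normal_density 0 \<sigma> s * (s - 0) ^ (2 * k)) (fact (2 * k) / ((2 / \<sigma>\<^sup>2) ^ k * fact k))"
    by (rule normal_moment_even) fact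
  have "((\<lambda>s. normal_density 0 \<sigma> s * (s - 0) ^ (2 * k)) has_integral (fact (2 * k) / ((2 / \<sigma>\<^sup>2) ^ k * fact k))) UNIV"
    using has_integral_integral_lborel[OF integrable.intros[OF m]] has_bochner_integral_integral_eq[OF m] by simp
  hence "((\<lambda>s. sqrt (2 * pi / z) * (normal_density 0 \<sigma> s * (s - 0) ^ (2 * k))) has_integral
     sqrt (2 * pi / z) * (fact (2 * k) / ((2 / \<sigma>\<^sup>2) ^ k * fact k))) UNIV"
    by (rule has_integral_mult_right)
  thus ?thesis unfolding nd \<sigma>(2) using z by simp
qed

text \<open>
  Outside the interval the integrand is at most \<open>s ^ 4 / s0 ^ 4\<close> times itself, which raises the order
  of the moment by four and gains a factor \<open>1 / z\<^sup>2\<close>.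
\<close>

lemma truncated_gaussian_even_moment:
  fixes z s0 :: real
  assumes z: "z > 0" and s0: "s0 > 0"
  shows "\<bar>integral {-s0..s0} (\<lambda>s. exp (- z * s\<^sup>2 / 2) * s ^ (2 * k))
            - sqrt (2 * pi / z) * (fact (2 * k) / ((2 * z) ^ k * fact k))\<bar>
         \<le> sqrt (2 * pi / z) * (fact (2 * (k + 2)) / ((2 * z) ^ (k + 2) * fact (k + 2))) / s0 ^ 4"
proof -
  define f where "f = (\<lambda>k s. exp (- z * s\<^sup>2 / 2) * s ^ (2 * k))"
  define I where "I = (\<lambda>k. sqrt (2 * pi / z) * (fact (2 * k) / ((2 * z) ^ k * fact k)))"
  have f: "(f k has_integral I k) UNIV" for k
    unfolding f_def I_def by (rule gaussian_even_moment[OF z])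
  have "f k integrable_on {-s0..s0}"
    unfolding f_def by (intro integrable_continuous_real continuous_intros) auto
  hence "(f k has_integral integral {-s0..s0} (f k)) {-s0..s0}" by (rule integrable_integral)
  hence "((\<lambda>s. if s \<in> {-s0..s0} then f k s else 0) has_integral integral {-s0..s0} (f k)) UNIV"
    by (subst has_integral_restrict_UNIV)
  from has_integral_diff[OF this f[of k]]
  have d: "((\<lambda>s. (if s \<in> {-s0..s0} then f k s else 0) - f k s) has_integral (integral {-s0..s0} (f k) - I k)) UNIV" .
  have t: "((\<lambda>s. f (k + 2) s / s0 ^ 4) has_integral I (k + 2) / s0 ^ 4) UNIV"
    using has_integral_divide[OF f[of "k + 2"]] .
  \<comment> \<open>The left-hand integrand is the part of the Gaussian outside the interval, with a minus sign.\<close>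
  have "norm (integral UNIV (\<lambda>s. (if s \<in> {-s0..s0} then f k s else 0) - f k s))
      \<le> integral UNIV (\<lambda>s. f (k + 2) s / s0 ^ 4)"
  proof (rule integral_norm_bound_integral)
    fix s :: real
    have nn: "f k s \<ge> 0" for k by (simp add: f_def)
    show "norm ((if s \<in> {-s0..s0} then f k s else 0) - f k s) \<le> f (k + 2) s / s0 ^ 4"
    proof (cases "s \<in> {-s0..s0}")
      case False
      hence "s0 \<le> \<bar>s\<bar>" by auto
      have e4: "2 * (k + 2) = 2 * k + 4" by simp
      from \<open>s0 \<le> \<bar>s\<bar>\<close> have "s0 ^ 4 \<le> \<bar>s\<bar> ^ 4" using s0 by (intro power_mono) auto
      hence "s0 ^ 4 \<le> s ^ 4" by simp
      hence "f k s * s0 ^ 4 \<le> f k s * s ^ 4" using nn by (intro mult_left_mono) auto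
      also have "f k s * s ^ 4 = f (k + 2) s"
        by (simp only: f_def e4 power_add mult.assoc)
      finally show ?thesis using False s0 nn by (simp add: field_simps)
    qed (use nn s0 in simp)
  qed (use d t in \<open>auto simp: has_integral_integrable\<close>)
  thus ?thesis
    unfolding integral_unique[OF d] integral_unique[OF t] by (simp only: f_def I_def real_norm_def)
qed

text \<open>Laplace\<close>

text \<open>
  With \<open>s = 2 sin (\<theta> / 2)\<close> one has \<open>cos \<theta> = 1 - s\<^sup>2 / 2\<close> and
  \<open>ds = cos (\<theta> / 2) d\<theta>\<close>. The remaining factor \<open>cos (2 \<theta>) / cos (\<theta> / 2)\<close> is
  \<open>1 - 15 / 8 * s\<^sup>2 + O(s ^ 4)\<close>, and the second moment of the Gaussian weight is \<open>1 / z\<close>.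
\<close>

lemma laplace_arc_integral:
  fixes \<phi> :: real
  assumes \<phi>: "0 < \<phi>" "\<phi> \<le> pi / 2"
  shows "\<exists>C. \<forall>z>0.
     \<bar>integral {-\<phi>..\<phi>} (\<lambda>\<theta>. cos (2 * \<theta>) * exp (z * cos \<theta>)) / (exp z * sqrt (2 * pi / z)) - (1 - 15 / (8 * z))\<bar>
       \<le> C / z\<^sup>2 + C / z ^ 3"
proof -
  define s0 where "s0 = 2 * sin (\<phi> / 2)"
  have s0: "s0 > 0" unfolding s0_def using \<phi> by (auto intro!: sin_gt_zero)
  have s0m: "2 * sin (- \<phi> / 2) = - s0" by (simp add: s0_def)
  define C where "C = 7 + 30 / s0 ^ 4"
  have "\<bar>integral {-\<phi>..\<phi>} (\<lambda>\<theta>. cos (2 * \<theta>) * exp (z * cos \<theta>)) / (exp z * sqrt (2 * pi / z)) - (1 - 15 / (8 * z))\<bar>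
       \<le> C / z\<^sup>2 + C / z ^ 3" if z: "z > 0" for z
  proof -
    define E where "E = (\<lambda>s. exp (- z * s\<^sup>2 / 2))"
    define S where "S = sqrt (2 * pi / z)"
    have S: "S > 0" using z by (simp add: S_def)
    define h where "h = (\<lambda>s. (1 - 15 / 8 * s\<^sup>2) * E s)"
    define m where "m = (\<lambda>k. integral {-s0..s0} (\<lambda>s. E s * s ^ (2 * k)))"
    have int: "(\<lambda>s. E s * s ^ (2 * k)) integrable_on {-s0..s0}" for k
      unfolding E_def by (intro integrable_continuous_real continuous_intros) auto
    have m: "\<bar>m k - S * (fact (2 * k) / ((2 * z) ^ k * fact k))\<bar>
         \<le> S * (fact (2 * (k + 2)) / ((2 * z) ^ (k + 2) * fact (k + 2))) / s0 ^ 4" for k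
      unfolding m_def E_def S_def by (rule truncated_gaussian_even_moment[OF z s0])
    have fct: "fact (2::nat) = (2::real)" "fact (3::nat) = (6::real)" "fact (4::nat) = (24::real)" "fact (6::nat) = (720::real)"
      by (simp_all add: fact_numeral)
    have m0: "\<bar>m 0 - S\<bar> \<le> S * (3 / z\<^sup>2) / s0 ^ 4"
      using m[of 0] by (simp add: fct power2_eq_square)
    have m1: "\<bar>m 1 - S / z\<bar> \<le> S * (15 / z ^ 3) / s0 ^ 4"
      using m[of 1] z by (simp add: fct power_mult_distrib numeral_3_eq_3[symmetric])
    have m2: "m 2 \<le> S * (3 / z\<^sup>2)"
    proof -
      have "m 2 \<le> integral UNIV (\<lambda>s. E s * s ^ (2 * 2))"
        unfolding m_def by (intro integral_subset_le int)
           (use gaussian_even_moment[OF z, of 2] in \<open>auto simp: E_def has_integral_integrable\<close>)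
      also have "\<dots> = S * (3 / z\<^sup>2)"
        using integral_unique[OF gaussian_even_moment[OF z, of 2]]
        by (simp add: E_def S_def fct power_mult_distrib)
      finally show ?thesis .
    qed
    have c: "cos (\<theta> / 2) \<ge> 1 / 2" if "\<theta> \<in> {-\<phi>..\<phi>}" for \<theta>
    proof -
      have "cos (\<theta> / 2) = cos (\<bar>\<theta>\<bar> / 2)" by (cases "\<theta> \<ge> 0") auto
      also have "\<dots> \<ge> cos (pi / 3)"
        by (rule cos_monotone_0_pi_le) (use that \<phi> pi_gt_zero in auto)
      finally show ?thesis by (simp add: cos_60)
    qed
    have sub: "((\<lambda>\<theta>. cos (\<theta> / 2) * g (2 * sin (\<theta> / 2))) has_integral integral {-s0..s0} g) {-\<phi>..\<phi>}"
      if g: "continuous_on UNIV g" for g :: "real \<Rightarrow> real"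
    proof -
      have "((\<lambda>\<theta>. cos (\<theta> / 2) *\<^sub>R g (2 * sin (\<theta> / 2))) has_integral
             integral {2 * sin (-\<phi> / 2)..2 * sin (\<phi> / 2)} g) {-\<phi>..\<phi>}"
      proof (rule has_integral_substitution[where c = "-2" and d = 2])
        show "continuous_on {-2..2} g" by (rule continuous_on_subset[OF g]) auto
        show "(\<lambda>\<theta>. 2 * sin (\<theta> / 2)) ` {-\<phi>..\<phi>} \<subseteq> {-2..2}"
          using sin_le_one sin_ge_minus_one by force
        show "((\<lambda>\<theta>. 2 * sin (\<theta> / 2)) has_field_derivative cos (\<theta> / 2)) (at \<theta> within {-\<phi>..\<phi>})" for \<theta>
          by (auto intro!: derivative_eq_intros)
        show "2 * sin (- \<phi> / 2) \<le> 2 * sin (\<phi> / 2)" using s0 s0m s0_def by simp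
      qed (use \<phi> in auto)
      thus ?thesis unfolding s0m by (simp add: s0_def)
    qed
    have e: "exp (z * cos \<theta>) = exp z * E (2 * sin (\<theta> / 2))" for \<theta>
    proof -
      have "cos \<theta> = 1 - (2 * sin (\<theta> / 2))\<^sup>2 / 2"
        using cos_double_sin[of "\<theta> / 2"] by (simp add: power_mult_distrib)
      hence "z * cos \<theta> = z * (1 - (2 * sin (\<theta> / 2))\<^sup>2 / 2)" by (rule arg_cong)
      also have "\<dots> = z + - z * (2 * sin (\<theta> / 2))\<^sup>2 / 2" by (simp add: algebra_simps)
      finally show ?thesis unfolding E_def by (simp only: exp_add)
    qed
    define J where "J = integral {-\<phi>..\<phi>} (\<lambda>\<theta>. cos (2 * \<theta>) * E (2 * sin (\<theta> / 2)))"
    have J: "((\<lambda>\<theta>. cos (2 * \<theta>) * E (2 * sin (\<theta> / 2))) has_integral J) {-\<phi>..\<phi>}"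
      unfolding J_def E_def by (intro integrable_integral integrable_continuous_real continuous_intros) auto
    have Jeq: "integral {-\<phi>..\<phi>} (\<lambda>\<theta>. cos (2 * \<theta>) * exp (z * cos \<theta>)) = exp z * J"
      unfolding J_def e by (subst integral_mult_right[symmetric]) (simp add: mult_ac)
    have H: "((\<lambda>\<theta>. cos (\<theta> / 2) * h (2 * sin (\<theta> / 2))) has_integral integral {-s0..s0} h) {-\<phi>..\<phi>}"
      by (rule sub) (auto simp: h_def E_def intro!: continuous_intros)
    have Q: "((\<lambda>\<theta>. cos (\<theta> / 2) * (E (2 * sin (\<theta> / 2)) * (2 * sin (\<theta> / 2)) ^ (2 * 2))) has_integral m 2) {-\<phi>..\<phi>}"
      unfolding m_def by (rule sub) (auto simp: E_def intro!: continuous_intros)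
    have "norm (integral {-\<phi>..\<phi>} (\<lambda>\<theta>. cos (2 * \<theta>) * E (2 * sin (\<theta> / 2)) - cos (\<theta> / 2) * h (2 * sin (\<theta> / 2))))
        \<le> integral {-\<phi>..\<phi>} (\<lambda>\<theta>. 7 / 3 * (cos (\<theta> / 2) * (E (2 * sin (\<theta> / 2)) * (2 * sin (\<theta> / 2)) ^ (2 * 2))))"
    proof (rule integral_norm_bound_integral)
      show "(\<lambda>\<theta>. cos (2 * \<theta>) * E (2 * sin (\<theta> / 2)) - cos (\<theta> / 2) * h (2 * sin (\<theta> / 2))) integrable_on {-\<phi>..\<phi>}"
        using has_integral_diff[OF J H] by (rule has_integral_integrable)
      show "(\<lambda>\<theta>. 7 / 3 * (cos (\<theta> / 2) * (E (2 * sin (\<theta> / 2)) * (2 * sin (\<theta> / 2)) ^ (2 * 2)))) integrable_on {-\<phi>..\<phi>}"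
        using has_integral_mult_right[OF Q] by (rule has_integral_integrable)
      fix \<theta> assume \<theta>: "\<theta> \<in> {-\<phi>..\<phi>}"
      define c where "c = cos (\<theta> / 2)"
      define s where "s = 2 * sin (\<theta> / 2)"
      have c1: "1 / 2 \<le> c" "c \<le> 1" using c[OF \<theta>] by (auto simp: c_def)
      have s2: "s\<^sup>2 = 4 * (1 - c\<^sup>2)" by (simp add: s_def c_def power_mult_distrib sin_squared_eq)
      have ct: "cos \<theta> = 2 * c\<^sup>2 - 1" using cos_double_cos[of "\<theta> / 2"] by (simp add: c_def)
      have c2t: "cos (2 * \<theta>) = 2 * (2 * c\<^sup>2 - 1)\<^sup>2 - 1" by (simp only: cos_double_cos ct)
      \<comment> \<open>The cofactor of \<open>(1 - c)\<^sup>2\<close> is a polynomial division: the left-hand side vanishes to second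
        order at \<open>c = 1\<close> exactly because of the coefficient \<open>15 / 8\<close>.\<close>
      have id: "cos (2 * \<theta>) - c * (1 - 15 / 8 * s\<^sup>2) = (1 - c)\<^sup>2 * (8 * c\<^sup>2 + 17 / 2 * c + 1)"
        unfolding c2t s2 by (simp add: power2_eq_square field_simps)
      have "(1 - c)\<^sup>2 * (8 * c\<^sup>2 + 17 / 2 * c + 1) \<le> (s\<^sup>2 / 4)\<^sup>2 * (35 / 2)"
      proof (intro mult_mono power_mono)
        have "c\<^sup>2 \<le> c" using c1 by (simp add: power2_eq_square mult_left_le)
        thus "1 - c \<le> s\<^sup>2 / 4" by (simp add: s2)
        have "c\<^sup>2 \<le> 1" using c1 by (simp add: abs_square_le_1)
        thus "8 * c\<^sup>2 + 17 / 2 * c + 1 \<le> 35 / 2" using c1 by simp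
      qed (use c1 in auto)
      also have "\<dots> \<le> 7 / 3 * (c * s ^ (2 * 2))"
      proof -
        have "1 / 2 * s ^ 4 \<le> c * s ^ 4" using c1 by (intro mult_right_mono) auto
        moreover have "s ^ 4 \<ge> 0" by simp
        moreover have "(s\<^sup>2 / 4)\<^sup>2 * (35 / 2) = 35 / 32 * s ^ 4" by (simp add: power_divide)
        moreover have "c * s ^ (2 * 2) = c * s ^ 4" by simp
        ultimately show ?thesis by linarith
      qed
      finally have b: "\<bar>cos (2 * \<theta>) - c * (1 - 15 / 8 * s\<^sup>2)\<bar> \<le> 7 / 3 * (c * s ^ (2 * 2))"
        using c1 unfolding id by (simp add: abs_mult)
      have Epos: "E s > 0" by (simp add: E_def)
      have "norm (cos (2 * \<theta>) * E s - c * h s) = \<bar>cos (2 * \<theta>) - c * (1 - 15 / 8 * s\<^sup>2)\<bar> * E s"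
      proof -
        have "cos (2 * \<theta>) * E s - c * h s = (cos (2 * \<theta>) - c * (1 - 15 / 8 * s\<^sup>2)) * E s"
          by (simp add: h_def algebra_simps)
        thus ?thesis using Epos by (simp only: real_norm_def abs_mult abs_of_pos)
      qed
      also have "\<dots> \<le> 7 / 3 * (c * s ^ (2 * 2)) * E s"
        using b Epos by (intro mult_right_mono) auto
      finally show "norm (cos (2 * \<theta>) * E (2 * sin (\<theta> / 2)) - cos (\<theta> / 2) * h (2 * sin (\<theta> / 2)))
         \<le> 7 / 3 * (cos (\<theta> / 2) * (E (2 * sin (\<theta> / 2)) * (2 * sin (\<theta> / 2)) ^ (2 * 2)))"
        by (simp add: c_def s_def mult_ac)
    qed
    hence e1: "\<bar>J - integral {-s0..s0} h\<bar> \<le> 7 / 3 * m 2"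
      unfolding integral_unique[OF has_integral_diff[OF J H]] integral_unique[OF has_integral_mult_right[OF Q]]
      by simp
    have hm: "integral {-s0..s0} h = m 0 - 15 / 8 * m 1"
    proof -
      have "((\<lambda>s. E s * s ^ (2 * 0) - 15 / 8 * (E s * s ^ (2 * 1))) has_integral (m 0 - 15 / 8 * m 1)) {-s0..s0}"
        unfolding m_def by (intro has_integral_diff has_integral_mult_right integrable_integral int)
      thus ?thesis by (intro integral_unique) (simp add: h_def power2_eq_square algebra_simps)
    qed
    have "\<bar>J - S * (1 - 15 / (8 * z))\<bar> = \<bar>(J - integral {-s0..s0} h) + (m 0 - S) - 15 / 8 * (m 1 - S / z)\<bar>"
    proof -
      have "S * (1 - 15 / (8 * z)) = S - 15 / 8 * (S / z)" by (simp add: right_diff_distrib)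
      thus ?thesis unfolding hm by (simp add: right_diff_distrib)
    qed
    also have "\<dots> \<le> 7 / 3 * m 2 + S * (3 / z\<^sup>2) / s0 ^ 4 + 15 / 8 * (S * (15 / z ^ 3) / s0 ^ 4)"
    proof -
      have "\<bar>u + v - 15 / 8 * w\<bar> \<le> U + V + 15 / 8 * W"
        if "\<bar>u\<bar> \<le> U" "\<bar>v\<bar> \<le> V" "\<bar>w\<bar> \<le> W" for u v w U V W :: real
        using that by linarith
      thus ?thesis using e1 m0 m1 by blast
    qed
    also have "\<dots> \<le> 7 / 3 * (S * (3 / z\<^sup>2)) + S * (3 / z\<^sup>2) / s0 ^ 4 + 15 / 8 * (S * (15 / z ^ 3) / s0 ^ 4)"
      using m2 by simp
    also have "\<dots> \<le> S * (C / z\<^sup>2 + C / z ^ 3)"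
    proof -
      have "3 / s0 ^ 4 \<le> 30 / s0 ^ 4" "225 / 8 / s0 ^ 4 \<le> 30 / s0 ^ 4"
        by (intro divide_right_mono; simp)+
      hence "7 + 3 / s0 ^ 4 \<le> C" "225 / 8 / s0 ^ 4 \<le> C"
        unfolding C_def by linarith+
      hence "(7 + 3 / s0 ^ 4) / z\<^sup>2 + (225 / 8 / s0 ^ 4) / z ^ 3 \<le> C / z\<^sup>2 + C / z ^ 3"
        using z by (intro add_mono divide_right_mono) auto
      hence "S * ((7 + 3 / s0 ^ 4) / z\<^sup>2 + (225 / 8 / s0 ^ 4) / z ^ 3) \<le> S * (C / z\<^sup>2 + C / z ^ 3)"
        using S by (intro mult_left_mono) auto
      thus ?thesis by (simp add: algebra_simps add_divide_distrib)
    qed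
    finally have "\<bar>J - S * (1 - 15 / (8 * z))\<bar> / S \<le> C / z\<^sup>2 + C / z ^ 3"
      using S by (simp add: divide_le_eq mult.commute)
    moreover have "exp z * J / (exp z * S) - (1 - 15 / (8 * z)) = (J - S * (1 - 15 / (8 * z))) / S"
      using S by (simp add: diff_divide_distrib)
    ultimately show ?thesis
      unfolding Jeq S_def[symmetric] using S by simp
  qed
  thus ?thesis by blast
qed

section \<open>Contour integration and the expansion of the coefficients\<close>

lemma exp_minus_15_over_le:
  fixes \<rho> :: real
  assumes "0 < \<rho>" "\<rho> \<le> 1"
  shows "8 * exp (- 15 / \<rho>) \<le> 1"
proof -
  have "exp (- 15 / \<rho>) \<le> exp (- 15)" using assms by (simp add: field_simps)
  also have "exp (- 15 :: real) \<le> 1 / 8"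
    using exp_ge_add_one_self[of "15 :: real"] by (simp add: exp_minus field_simps)
  finally show ?thesis by simp
qed

lemma norm_diff_vertical_le:
  assumes \<Phi>: "\<And>t. Re t > 0 \<Longrightarrow> (\<Phi> has_field_derivative G t) (at t)"
    and x: "x > 0" and y: "y0 \<le> y1"
    and B: "\<And>y. y0 \<le> y \<Longrightarrow> y \<le> y1 \<Longrightarrow> norm (G (Complex x y)) \<le> B"
  shows "norm (\<Phi> (Complex x y1) - \<Phi> (Complex x y0)) \<le> B * (y1 - y0)"
proof -
  let ?S = "closed_segment (Complex x y0) (Complex x y1)"
  have S: "\<exists>y. t = Complex x y \<and> y0 \<le> y \<and> y \<le> y1" if "t \<in> ?S" for t
  proof -
    from that obtain u where u: "0 \<le> u" "u \<le> 1" "t = (1 - u) *\<^sub>R Complex x y0 + u *\<^sub>R Complex x y1"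
      by (auto simp: closed_segment_def)
    have "t = Complex x (y0 + u * (y1 - y0))"
      unfolding u(3) by (simp add: complex_eq_iff algebra_simps)
    moreover have "u * (y1 - y0) \<le> 1 * (y1 - y0)" using u y by (intro mult_right_mono) auto
    ultimately show ?thesis using u y by (intro exI[of _ "y0 + u * (y1 - y0)"]) auto
  qed
  have "norm (\<Phi> (Complex x y1) - \<Phi> (Complex x y0)) \<le> B * norm (Complex x y1 - Complex x y0)"
  proof (rule field_differentiable_bound[where S = ?S and f' = G])
    fix t assume "t \<in> ?S"
    then obtain w where w: "t = Complex x w" "y0 \<le> w" "w \<le> y1" using S by blast
    show "(\<Phi> has_field_derivative G t) (at t within ?S)"
      using \<Phi>[of t] x w by (simp add: has_field_derivative_at_within)
    show "norm (G t) \<le> B" using B w by simp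
  qed auto
  also have "Complex x y1 - Complex x y0 = of_real (y1 - y0) * \<i>"
    by (simp add: complex_eq_iff)
  also have "norm \<dots> = y1 - y0" using y by (simp only: norm_mult norm_of_real norm_ii) simp
  finally show ?thesis .
qed

text \<open>
  On the vertical line \<open>Re t = x = 4 / 5 * \<rho>\<close> the trivial bound by the value at the real point
  \<open>x\<close> has exponent \<open>\<pi>\<^sup>2 / (4 x) + N x = (5 / 8 + 2 / 5) z\<close>, slightly more than the exponent
  \<open>z\<close> of the main term. The gain \<open>- 23 / (100 \<rho>) \<le> - 23 / 500 * z\<close> brings it below \<open>z\<close>.
\<close>

lemma minor_arc_bound:
  assumes N: "real n - 1 / 8 = N" "N > 0"
    and \<rho>: "\<rho> = pi / (2 * sqrt N)" "\<rho> \<le> 1" and z: "z = pi * sqrt N"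
    and t: "t = Complex (4 / 5 * \<rho>) y"
    and e: "exp (- (4 / 5 * \<rho>)) / norm (1 - exp (- t))
       - exp (- (4 / 5 * \<rho>)) / (1 - exp (- (4 / 5 * \<rho>))) \<le> - (23 / 100) / \<rho>"
  shows "norm (cubic_gf_fun (exp (- t)) * exp (of_nat n * t)) \<le> 3 * \<rho> / (sqrt 2 * pi) * exp (49 / 50 * z)"
proof -
  define x where "x = 4 / 5 * \<rho>"
  have \<rho>0: "\<rho> > 0" using N \<rho> by simp
  have x: "x > 0" "x \<le> 1" "x \<le> \<rho>" using \<rho>0 \<rho>(2) by (auto simp: x_def)
  have z0: "z > 0" using N z by simp
  have rz: "\<rho> = pi\<^sup>2 / (2 * z)" "N * \<rho> = z / 2" "pi\<^sup>2 / \<rho> = 2 * z"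
    using N(2) unfolding \<rho>(1) z by (simp_all add: field_simps power2_eq_square)
  have nq: "norm (exp (- t)) = exp (- x)" by (simp add: t x_def)
  have "norm (cubic_gf_fun (exp (- t))) \<le> norm (cubic_gf_fun (of_real (exp (- x)))) * exp (- (23 / 100) / \<rho>)"
  proof -
    have "norm (cubic_gf_fun (exp (- t))) \<le> norm (cubic_gf_fun (of_real (exp (- x)))) *
       exp (exp (- x) / norm (1 - exp (- t)) - exp (- x) / (1 - exp (- x)))"
      using norm_cubic_gf_fun_le[of "exp (- t)"] x unfolding nq by simp
    also have "\<dots> \<le> norm (cubic_gf_fun (of_real (exp (- x)))) * exp (- (23 / 100) / \<rho>)"
      using e by (intro mult_left_mono) (auto simp: x_def)
    finally show ?thesis .
  qed
  also have "norm (cubic_gf_fun (of_real (exp (- x)))) \<le> 3 * \<rho> / (sqrt 2 * pi) * exp (pi\<^sup>2 / (4 * x) - x / 8)"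
  proof -
    have "norm (dual_log (of_real x)) \<le> 8 * exp (- 15 / x)"
      by (rule norm_dual_log_le) (use x in auto)
    also have "\<dots> \<le> 1" by (rule exp_minus_15_over_le) (use x in auto)
    finally have d: "norm (exp (dual_log (of_real x))) \<le> 3"
      using norm_exp[of "dual_log (of_real x)"] exp_le
      by (meson exp_le_cancel_iff order_trans)
    have "cubic_gf_fun (of_real (exp (- x))) = cubic_gf_fun (exp (- of_real x))"
      by (simp flip: exp_of_real)
    also have "\<dots> = of_real x / of_real (sqrt 2 * pi) * exp ((of_real pi)\<^sup>2 / (4 * of_real x) - of_real x / 8)
         * exp (dual_log (of_real x))"
      by (rule cubic_gf_fun_modular) (use x in simp)
    also have "(of_real pi)\<^sup>2 / (4 * of_real x) - of_real x / 8 = complex_of_real (pi\<^sup>2 / (4 * x) - x / 8)"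
      by simp
    also have "norm (of_real x / of_real (sqrt 2 * pi) * exp (complex_of_real (pi\<^sup>2 / (4 * x) - x / 8))
         * exp (dual_log (of_real x))) = x / (sqrt 2 * pi) * exp (pi\<^sup>2 / (4 * x) - x / 8) * norm (exp (dual_log (of_real x)))"
      unfolding exp_of_real norm_mult norm_divide norm_of_real using x by (simp add: abs_mult)
    also have "\<dots> \<le> \<rho> / (sqrt 2 * pi) * exp (pi\<^sup>2 / (4 * x) - x / 8) * 3"
      using x d \<rho>0 by (intro mult_mono divide_right_mono) auto
    finally show ?thesis by (simp add: mult_ac)
  qed
  finally have "norm (cubic_gf_fun (exp (- t))) \<le>
      3 * \<rho> / (sqrt 2 * pi) * exp (pi\<^sup>2 / (4 * x) - x / 8) * exp (- (23 / 100) / \<rho>)"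
    by (simp add: mult_right_mono)
  hence "norm (cubic_gf_fun (exp (- t))) * norm (exp (of_nat n * t)) \<le>
      3 * \<rho> / (sqrt 2 * pi) * exp (pi\<^sup>2 / (4 * x) - x / 8) * exp (- (23 / 100) / \<rho>) * exp (real n * x)"
    using \<rho>0 by (intro mult_mono) (auto simp: t x_def)
  also have "\<dots> = 3 * \<rho> / (sqrt 2 * pi) * exp (pi\<^sup>2 / (4 * x) - x / 8 + - (23 / 100) / \<rho> + real n * x)"
    unfolding exp_add by (simp only: mult_ac)
  also have "pi\<^sup>2 / (4 * x) - x / 8 + - (23 / 100) / \<rho> + real n * x \<le> 49 / 50 * z"
  proof -
    have "pi\<^sup>2 / (4 * x) = 5 / 16 * (pi\<^sup>2 / \<rho>)" using \<rho>0 by (simp add: x_def)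
    hence 1: "pi\<^sup>2 / (4 * x) = 5 / 8 * z" unfolding rz(3) by simp
    have "real n * x - x / 8 = 4 / 5 * (N * \<rho>)" unfolding N(1)[symmetric] x_def by (simp add: algebra_simps)
    hence 2: "real n * x - x / 8 = 2 / 5 * z" unfolding rz(2) by simp
    have "pi\<^sup>2 \<le> 10"
    proof -
      have "pi\<^sup>2 \<le> (3.15 :: real)\<^sup>2" using pi_approx by (intro power_mono) auto
      thus ?thesis by (simp add: power2_eq_square)
    qed
    hence "pi\<^sup>2 / \<rho> \<le> 10 / \<rho>" using \<rho>0 by (intro divide_right_mono) auto
    hence "z / 5 \<le> 1 / \<rho>" unfolding rz(3) by simp
    hence 3: "- (23 / 100) / \<rho> \<le> - (23 / 500) * z" by (simp add: field_simps)
    show ?thesis using 1 2 3 z0 by linarith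
  qed
  finally show ?thesis using \<rho>0 by (simp add: norm_mult mult_left_mono divide_right_mono)
qed

text \<open>
  On the arc \<open>t = \<rho> exp (\<i> \<theta>)\<close> the modular form of the generating function gives the
  integrand \<open>\<i> K exp (2 \<i> \<theta>) exp (z cos \<theta>) exp R(t)\<close> with \<open>K = \<rho>\<^sup>2 / (sqrt 2 \<pi>)\<close>;
  the real part after division by \<open>\<i> K\<close> is the Laplace integral up to the error from
  \<open>exp R(t) - 1\<close>.
\<close>

lemma major_arc_integral:
  assumes \<Phi>: "\<And>t. Re t > 0 \<Longrightarrow> (\<Phi> has_field_derivative cubic_gf_fun (exp (- t)) * exp (of_nat n * t)) (at t)"
    and N: "real n - 1 / 8 = N" "N > 0"
    and \<rho>: "\<rho> = pi / (2 * sqrt N)" "\<rho> \<le> 1" and z: "z = pi * sqrt N"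
    and \<phi>: "0 < \<phi>" "\<phi> \<le> pi / 2" "cos \<phi> = 4 / 5"
  shows "\<bar>Re ((\<Phi> (of_real \<rho> * cis \<phi>) - \<Phi> (of_real \<rho> * cis (- \<phi>))) / (\<i> * of_real (\<rho>\<^sup>2 / (sqrt 2 * pi))))
          - integral {-\<phi>..\<phi>} (\<lambda>\<theta>. cos (2 * \<theta>) * exp (z * cos \<theta>))\<bar>
         \<le> 48 * \<phi> * (exp z * exp (- 15 / \<rho>))"
proof -
  define K where "K = \<rho>\<^sup>2 / (sqrt 2 * pi)"
  define G where "G = (\<lambda>t. cubic_gf_fun (exp (- t)) * exp (of_nat n * t))"
  have \<rho>0: "\<rho> > 0" using N \<rho> by simp
  have K: "K > 0" using \<rho>0 by (simp add: K_def)
  have rz: "N * \<rho> = z / 2" "pi\<^sup>2 / (4 * \<rho>) = z / 2"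
    using N(2) unfolding \<rho>(1) z by (simp_all add: field_simps power2_eq_square)
  have cos_ge: "cos \<theta> \<ge> 4 / 5" if "\<theta> \<in> {-\<phi>..\<phi>}" for \<theta>
  proof -
    have "cos \<phi> \<le> cos \<bar>\<theta>\<bar>" using that \<phi> by (intro cos_monotone_0_pi_le) auto
    thus ?thesis using \<phi>(3) by (simp add: abs_if split: if_splits)
  qed
  have Gt: "G (of_real \<rho> * cis \<theta>) * (of_real \<rho> * \<i> * cis \<theta>) =
     \<i> * of_real K * (cis (2 * \<theta>) * of_real (exp (z * cos \<theta>)) * exp (dual_log (of_real \<rho> * cis \<theta>)))"
    if \<theta>: "\<theta> \<in> {-\<phi>..\<phi>}" for \<theta>
  proof -
    define t where "t = of_real \<rho> * cis \<theta>"
    have t0: "t \<noteq> 0" using \<rho>0 by (simp add: t_def)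
    have Ret: "Re t > 0" using cos_ge[OF \<theta>] \<rho>0 by (simp add: t_def)
    have inv: "1 / t = of_real (1 / \<rho>) * cis (- \<theta>)"
      by (simp add: t_def divide_inverse cis_inverse)
    have "(of_real pi)\<^sup>2 / (4 * t) = of_real (pi\<^sup>2 / 4) * (1 / t)" by simp
    also have "\<dots> = of_real (pi\<^sup>2 / (4 * \<rho>)) * cis (- \<theta>)" unfolding inv by simp
    finally have e1: "(of_real pi)\<^sup>2 / (4 * t) = of_real (z / 2) * cis (- \<theta>)" unfolding rz .
    have "of_nat n * t - t / 8 = of_real (real n - 1 / 8) * t" by (simp add: algebra_simps)
    also have "\<dots> = of_real (N * \<rho>) * cis \<theta>" unfolding N t_def by simp
    finally have e2: "of_nat n * t - t / 8 = of_real (z / 2) * cis \<theta>" unfolding rz .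
    have "(of_real pi)\<^sup>2 / (4 * t) - t / 8 + of_nat n * t = (of_real pi)\<^sup>2 / (4 * t) + (of_nat n * t - t / 8)"
      by simp
    also have "\<dots> = of_real (z / 2) * cis (- \<theta>) + of_real (z / 2) * cis \<theta>"
      by (simp only: e1 e2)
    also have "\<dots> = of_real (z * cos \<theta>)" by (simp add: complex_eq_iff)
    finally have e: "exp ((of_real pi)\<^sup>2 / (4 * t) - t / 8) * exp (of_nat n * t) = of_real (exp (z * cos \<theta>))"
      by (simp only: exp_add[symmetric] exp_of_real)
    have t2: "t * t = of_real (\<rho>\<^sup>2) * cis (2 * \<theta>)"
      by (simp add: t_def cis_mult power2_eq_square mult_ac flip: mult_2) 
    have "G t * (\<i> * t) = \<i> * (t * t) / of_real (sqrt 2 * pi) *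
       (exp ((of_real pi)\<^sup>2 / (4 * t) - t / 8) * exp (of_nat n * t)) * exp (dual_log t)"
      unfolding G_def cubic_gf_fun_modular[OF Ret] by simp
    also have "\<dots> = \<i> * of_real K * (cis (2 * \<theta>) * of_real (exp (z * cos \<theta>)) * exp (dual_log t))"
      unfolding e t2 K_def by simp
    finally show ?thesis by (simp add: t_def mult_ac)
  qed
  define h where "h = (\<lambda>\<theta>. cis (2 * \<theta>) * of_real (exp (z * cos \<theta>)))"
  have I: "((\<lambda>\<theta>. \<i> * of_real K * (h \<theta> * exp (dual_log (of_real \<rho> * cis \<theta>)))) has_integral
       (\<Phi> (of_real \<rho> * cis \<phi>) - \<Phi> (of_real \<rho> * cis (- \<phi>)))) {-\<phi>..\<phi>}"
  proof (rule fundamental_theorem_of_calculus)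
    fix \<theta> assume \<theta>: "\<theta> \<in> {-\<phi>..\<phi>}"
    have c: "of_real \<rho> * exp (\<i> * of_real \<theta>) = of_real \<rho> * cis \<theta>" for \<theta> by (simp add: cis_conv_exp)
    have "Re (of_real \<rho> * exp (\<i> * of_real \<theta>)) > 0" unfolding c using cos_ge[OF \<theta>] \<rho>0 by simp
    from \<Phi>[OF this] have "(\<Phi> has_field_derivative G (of_real \<rho> * exp (\<i> * of_real \<theta>))) (at (of_real \<rho> * exp (\<i> * of_real \<theta>)))"
      by (simp only: G_def)
    hence "((\<lambda>w. \<Phi> (of_real \<rho> * exp (\<i> * w))) has_field_derivative
         (G (of_real \<rho> * exp (\<i> * of_real \<theta>)) * (of_real \<rho> * (exp (\<i> * of_real \<theta>) * \<i>)))) (at (of_real \<theta>))"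
      by (rule DERIV_chain2) (auto intro!: derivative_eq_intros)
    from has_vector_derivative_real_field[OF this, of "{-\<phi>..\<phi>}"]
    have "((\<lambda>\<theta>. \<Phi> (of_real \<rho> * cis \<theta>)) has_vector_derivative
         (G (of_real \<rho> * cis \<theta>) * (of_real \<rho> * (cis \<theta> * \<i>)))) (at \<theta> within {-\<phi>..\<phi>})"
      by (simp only: cis_conv_exp)
    also have "G (of_real \<rho> * cis \<theta>) * (of_real \<rho> * (cis \<theta> * \<i>)) = G (of_real \<rho> * cis \<theta>) * (of_real \<rho> * \<i> * cis \<theta>)"
      by (simp only: mult_ac)
    also have "\<dots> = \<i> * of_real K * (h \<theta> * exp (dual_log (of_real \<rho> * cis \<theta>)))"
      unfolding Gt[OF \<theta>] h_def ..
    finally show "((\<lambda>\<theta>. \<Phi> (of_real \<rho> * cis \<theta>)) has_vector_derivative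
         \<i> * of_real K * (h \<theta> * exp (dual_log (of_real \<rho> * cis \<theta>)))) (at \<theta> within {-\<phi>..\<phi>})" .
  qed (use \<phi> in auto)
  define W where "W = (\<Phi> (of_real \<rho> * cis \<phi>) - \<Phi> (of_real \<rho> * cis (- \<phi>))) / (\<i> * of_real K)"
  have "((\<lambda>\<theta>. \<i> * of_real K * (h \<theta> * exp (dual_log (of_real \<rho> * cis \<theta>))) / (\<i> * of_real K)) has_integral W) {-\<phi>..\<phi>}"
    unfolding W_def by (rule has_integral_divide[OF I])
  hence I': "((\<lambda>\<theta>. h \<theta> * exp (dual_log (of_real \<rho> * cis \<theta>))) has_integral W) {-\<phi>..\<phi>}"
    using K by simp
  have hi: "h integrable_on {-\<phi>..\<phi>}"
    unfolding h_def cis_conv_exp by (intro integrable_continuous_real continuous_intros)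
  have dif: "((\<lambda>\<theta>. h \<theta> * exp (dual_log (of_real \<rho> * cis \<theta>)) - h \<theta>) has_integral (W - integral {-\<phi>..\<phi>} h)) {-\<phi>..\<phi>}"
    by (intro has_integral_diff I' integrable_integral hi)
  have b: "norm (h \<theta> * exp (dual_log (of_real \<rho> * cis \<theta>)) - h \<theta>) \<le> exp z * (24 * exp (- 15 / \<rho>))"
    if \<theta>: "\<theta> \<in> {-\<phi>..\<phi>}" for \<theta>
  proof -
    define d where "d = dual_log (of_real \<rho> * cis \<theta>)"
    have d: "norm d \<le> 8 * exp (- 15 / \<rho>)"
      unfolding d_def using \<rho>0 \<rho>(2) cos_ge[OF \<theta>] by (intro norm_dual_log_le) (auto simp: norm_mult)
    hence "norm d \<le> 1" using exp_minus_15_over_le[OF \<rho>0 \<rho>(2)] by linarith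
    hence "norm (exp d - 1) \<le> 3 * norm d" by (rule norm_exp_minus_one_le)
    hence d': "norm (exp d - 1) \<le> 24 * exp (- 15 / \<rho>)" using d by simp
    have "z > 0" using N z by simp
    hence "z * cos \<theta> \<le> z" using cos_le_one[of \<theta>] by simp
    hence "norm (h \<theta>) \<le> exp z" by (simp add: h_def norm_mult)
    hence "norm (h \<theta>) * norm (exp d - 1) \<le> exp z * (24 * exp (- 15 / \<rho>))"
      using d' by (intro mult_mono) auto
    thus ?thesis unfolding d_def[symmetric] norm_mult[symmetric] by (simp add: right_diff_distrib)
  qed
  have "norm (W - integral {-\<phi>..\<phi>} h) \<le> exp z * (24 * exp (- 15 / \<rho>)) * measure lborel {-\<phi>..\<phi>}"
    by (rule has_integral_bound_real[OF _ _ dif, of _ "{}"]) (use b in auto)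
  hence n: "norm (W - integral {-\<phi>..\<phi>} h) \<le> 48 * \<phi> * (exp z * exp (- 15 / \<rho>))"
    using \<phi> by (simp add: mult_ac)
  have "Re (integral {-\<phi>..\<phi>} h) = integral {-\<phi>..\<phi>} (\<lambda>\<theta>. Re (h \<theta>))"
    by (simp add: integral_linear[OF hi bounded_linear_Re, unfolded o_def])
  also have "(\<lambda>\<theta>. Re (h \<theta>)) = (\<lambda>\<theta>. cos (2 * \<theta>) * exp (z * cos \<theta>))" by (simp add: h_def)
  finally have "Re W - integral {-\<phi>..\<phi>} (\<lambda>\<theta>. cos (2 * \<theta>) * exp (z * cos \<theta>)) = Re (W - integral {-\<phi>..\<phi>} h)"
    by simp
  hence "\<bar>Re W - integral {-\<phi>..\<phi>} (\<lambda>\<theta>. cos (2 * \<theta>) * exp (z * cos \<theta>))\<bar> \<le> norm (W - integral {-\<phi>..\<phi>} h)"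
    using abs_Re_le_cmod by presburger
  with n show ?thesis unfolding W_def K_def by linarith
qed

text \<open>
  The increment of the primitive from \<open>x - \<pi> \<i>\<close> to \<open>x + \<pi> \<i>\<close>, split at the two end
  points of the arc. The normalisation is \<open>2 \<pi> / K = 8 sqrt 2 N\<close>.
\<close>

lemma cubic_partition_vs_laplace:
  assumes \<phi>: "\<phi> = arccos (4 / 5)"
  shows "\<forall>\<^sub>F n in sequentially. let z = pi * sqrt (real n - 1 / 8) in
     \<bar>8 * sqrt 2 * (real n - 1 / 8) * cubic_partition n - integral {-\<phi>..\<phi>} (\<lambda>\<theta>. cos (2 * \<theta>) * exp (z * cos \<theta>))\<bar>
       \<le> 96 * exp (- 2 * z) + 19 * z * exp (49 / 50 * z)"
proof -
  have cphi: "cos \<phi> = 4 / 5" by (simp add: \<phi> cos_arccos)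
  have \<phi>b: "0 < \<phi>" "\<phi> \<le> pi / 2"
    unfolding \<phi> using arccos_lt_bounded[of "4 / 5"] arccos_le_pi2[of "4 / 5"] by auto
  have sphi: "sin \<phi> = 3 / 5"
  proof -
    have "(sin \<phi>)\<^sup>2 = (3 / 5)\<^sup>2" using sin_cos_squared_add[of \<phi>] unfolding cphi by (simp add: power2_eq_square)
    moreover have "sin \<phi> \<ge> 0" using \<phi>b by (intro sin_ge_zero) auto
    ultimately show ?thesis by (simp add: power2_eq_iff_nonneg)
  qed
  have "filterlim (\<lambda>n. pi / (2 * sqrt (real n - 1 / 8))) (at_right 0) sequentially"
    by real_asymp
  note ev = eventually_compose_filterlim[OF minor_arc_exponent this]
  have "((\<lambda>n. pi / (2 * sqrt (real n - 1 / 8))) \<longlongrightarrow> 0) sequentially" by real_asymp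
  hence ev1: "\<forall>\<^sub>F n in sequentially. pi / (2 * sqrt (real n - 1 / 8)) < 1"
    by (rule order_tendstoD) simp
  from ev ev1 eventually_gt_at_top[of 0] show ?thesis
  proof eventually_elim
    case (elim n)
    define N where "N = real n - 1 / 8"
    define \<rho> where "\<rho> = pi / (2 * sqrt N)"
    define z where "z = pi * sqrt N"
    define K where "K = \<rho>\<^sup>2 / (sqrt 2 * pi)"
    define J where "J = integral {-\<phi>..\<phi>} (\<lambda>\<theta>. cos (2 * \<theta>) * exp (z * cos \<theta>))"
    define B where "B = 3 * \<rho> / (sqrt 2 * pi) * exp (49 / 50 * z)"
    have "real n \<ge> 1" using elim(3) by simp
    hence N: "real n - 1 / 8 = N" "N > 0" by (auto simp: N_def)
    have \<rho>: "\<rho> > 0" "\<rho> \<le> 1" using N elim(2) by (auto simp: \<rho>_def)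
    have K: "K > 0" using \<rho> by (simp add: K_def)
    obtain \<Phi> where \<Phi>: "\<And>t. Re t > 0 \<Longrightarrow> (\<Phi> has_field_derivative cubic_gf_fun (exp (- t)) * exp (of_nat n * t)) (at t)"
      and a: "\<And>x. x > 0 \<Longrightarrow> \<Phi> (Complex x pi) - \<Phi> (Complex x (- pi)) = 2 * pi * \<i> * of_real (cubic_partition n)"
      using cubic_partition_primitive[of n] by blast
    define x where "x = 4 / 5 * \<rho>"
    have x: "x > 0" using \<rho> by (simp add: x_def)
    have e1: "of_real \<rho> * cis \<phi> = Complex x (3 / 5 * \<rho>)" "of_real \<rho> * cis (- \<phi>) = Complex x (- (3 / 5 * \<rho>))"
      by (simp_all add: complex_eq_iff cphi sphi x_def)
    have bnd: "norm (cubic_gf_fun (exp (- Complex x y)) * exp (of_nat n * Complex x y)) \<le> B"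
      if y: "3 / 5 * \<rho> \<le> \<bar>y\<bar>" "\<bar>y\<bar> \<le> pi" for y
      unfolding B_def
    proof (rule minor_arc_bound[OF N \<rho>_def \<rho>(2) z_def])
      show "Complex x y = Complex (4 / 5 * \<rho>) y" by (simp add: x_def)
      show "exp (- (4 / 5 * \<rho>)) / norm (1 - exp (- Complex x y))
       - exp (- (4 / 5 * \<rho>)) / (1 - exp (- (4 / 5 * \<rho>))) \<le> - (23 / 100) / \<rho>"
        using elim(1) y unfolding N_def[symmetric] \<rho>_def[symmetric] x_def by blast
    qed
    have pi1: "3 / 5 * \<rho> \<le> pi" using \<rho> pi_gt3 by linarith
    have B0: "B \<ge> 0" using \<rho> by (simp add: B_def)
    have "norm (\<Phi> (Complex x pi) - \<Phi> (Complex x (3 / 5 * \<rho>))) \<le> B * (pi - 3 / 5 * \<rho>)"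
      by (rule norm_diff_vertical_le[OF \<Phi> x pi1]) (use \<rho> bnd in auto)
    also have "\<dots> \<le> B * pi" using B0 \<rho> by (intro mult_left_mono) auto
    finally have s1: "norm (\<Phi> (Complex x pi) - \<Phi> (Complex x (3 / 5 * \<rho>))) \<le> B * pi" .
    have "norm (\<Phi> (Complex x (- (3 / 5 * \<rho>))) - \<Phi> (Complex x (- pi))) \<le> B * (- (3 / 5 * \<rho>) - (- pi))"
      by (rule norm_diff_vertical_le[OF \<Phi> x]) (use \<rho> bnd pi1 in auto)
    also have "\<dots> \<le> B * pi" using B0 \<rho> by (intro mult_left_mono) auto
    finally have s2: "norm (\<Phi> (Complex x (- (3 / 5 * \<rho>))) - \<Phi> (Complex x (- pi))) \<le> B * pi" .
    define A where "A = \<Phi> (of_real \<rho> * cis \<phi>) - \<Phi> (of_real \<rho> * cis (- \<phi>))"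
    have m: "\<bar>Re (A / (\<i> * of_real K)) - J\<bar> \<le> 48 * \<phi> * (exp z * exp (- 15 / \<rho>))"
      unfolding A_def K_def J_def by (rule major_arc_integral[OF \<Phi> N \<rho>_def \<rho>(2) z_def \<phi>b cphi])
    have eq: "2 * pi * \<i> * of_real (cubic_partition n) - A =
        (\<Phi> (Complex x pi) - \<Phi> (Complex x (3 / 5 * \<rho>))) + (\<Phi> (Complex x (- (3 / 5 * \<rho>))) - \<Phi> (Complex x (- pi)))"
      unfolding a[OF x, symmetric] A_def e1 by simp
    have d: "norm (2 * pi * \<i> * of_real (cubic_partition n) - A) \<le> 2 * pi * B"
      unfolding eq using norm_triangle_mono[OF s1 s2] by (simp add: mult_ac)
    have "of_real (2 * pi * cubic_partition n / K) - A / (\<i> * of_real K) =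
       (2 * pi * \<i> * of_real (cubic_partition n) - A) / (\<i> * of_real K)"
      using K by (simp add: field_simps)
    hence "norm (of_real (2 * pi * cubic_partition n / K) - A / (\<i> * of_real K)) =
        norm (2 * pi * \<i> * of_real (cubic_partition n) - A) / K"
      using K by (simp only: norm_divide norm_mult norm_ii norm_of_real mult_1 abs_of_pos)
    also have "\<dots> \<le> 2 * pi * B / K" using d K by (intro divide_right_mono) auto
    finally have "norm (of_real (2 * pi * cubic_partition n / K) - A / (\<i> * of_real K)) \<le> 2 * pi * B / K" .
    hence "\<bar>Re (of_real (2 * pi * cubic_partition n / K) - A / (\<i> * of_real K))\<bar> \<le> 2 * pi * B / K"
      using abs_Re_le_cmod order_trans by blast
    hence r: "\<bar>2 * pi * cubic_partition n / K - Re (A / (\<i> * of_real K))\<bar> \<le> 2 * pi * B / K"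
      by (simp only: minus_complex.sel Re_complex_of_real)
    have rz: "pi\<^sup>2 / \<rho> = 2 * z"
      using N(2) unfolding \<rho>_def z_def by (simp add: field_simps power2_eq_square)
    have z0: "z > 0" using N by (simp add: z_def)
    have pi2: "9 \<le> pi\<^sup>2" "pi\<^sup>2 \<le> 10"
    proof -
      have "3\<^sup>2 \<le> pi\<^sup>2" by (rule power_mono) (use pi_gt3 in auto)
      moreover have "pi\<^sup>2 \<le> (3.15 :: real)\<^sup>2" using pi_approx by (intro power_mono) auto
      ultimately show "9 \<le> pi\<^sup>2" "pi\<^sup>2 \<le> 10" by (auto simp: power2_eq_square)
    qed
    have "9 / \<rho> \<le> pi\<^sup>2 / \<rho>" "pi\<^sup>2 / \<rho> \<le> 10 / \<rho>" using \<rho> pi2 by (auto intro!: divide_right_mono)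
    hence rb: "9 / \<rho> \<le> 2 * z" "2 * z \<le> 10 / \<rho>" unfolding rz by auto
    have KB: "2 * pi * B / K = 6 * pi * (1 / \<rho>) * exp (49 / 50 * z)"
      unfolding B_def K_def using \<rho> by (simp add: power2_eq_square)
    also have "\<dots> \<le> 19 * z * exp (49 / 50 * z)"
    proof -
      have "6 * pi \<le> 19" using pi_approx by simp
      moreover have "1 / \<rho> \<le> z" using rb z0 by simp
      ultimately show ?thesis using \<rho> by (intro mult_right_mono mult_mono) auto
    qed
    finally have t1: "2 * pi * B / K \<le> 19 * z * exp (49 / 50 * z)" .
    have "48 * \<phi> * (exp z * exp (- 15 / \<rho>)) \<le> 48 * 2 * exp (- 2 * z)"
    proof (intro mult_mono)
      show "\<phi> \<le> 2" using \<phi>b pi_less_4 by simp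
      have "z + - 15 / \<rho> \<le> - 2 * z" using rb by (simp add: field_simps)
      thus "exp z * exp (- 15 / \<rho>) \<le> exp (- 2 * z)" by (simp only: exp_add[symmetric] exp_le_cancel_iff)
    qed (use \<phi>b in auto)
    hence t2: "48 * \<phi> * (exp z * exp (- 15 / \<rho>)) \<le> 96 * exp (- 2 * z)" by simp
    have KN: "2 * pi * cubic_partition n / K = 8 * sqrt 2 * N * cubic_partition n"
      unfolding K_def \<rho>_def using N(2) by (simp add: power_divide power_mult_distrib field_simps power2_eq_square)
    show ?case unfolding Let_def N_def[symmetric] z_def[symmetric] J_def[symmetric]
      using r m t1 t2 unfolding KN by linarith
  qed
qed

text \<open>
  The prefactors combine as
  \<open>exp z * sqrt (2 \<pi> / z) / (8 sqrt 2 N) = exp z / (8 N powr (5 / 4))\<close>, since \<open>z = \<pi> sqrt N\<close>.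
\<close>

theorem cubic_partition_second_order:
  fixes z :: "nat \<Rightarrow> real"
  defines "z \<equiv> (\<lambda>n. pi * sqrt (real n - 1 / 8))"
  shows "(\<lambda>n. sqrt (real n) *
     (8 * (real n - 1 / 8) powr (5 / 4) * cubic_partition n / exp (z n) - 1)) \<longlonglongrightarrow> - 15 / (8 * pi)"
proof -
  define \<phi> where "\<phi> = arccos (4 / 5 :: real)"
  have \<phi>b: "0 < \<phi>" "\<phi> \<le> pi / 2"
    unfolding \<phi>_def using arccos_lt_bounded[of "4 / 5"] arccos_le_pi2[of "4 / 5"] by auto
  define J where "J = (\<lambda>z. integral {-\<phi>..\<phi>} (\<lambda>\<theta>. cos (2 * \<theta>) * exp (z * cos \<theta>)))"
  obtain C where C: "\<And>z. z > 0 \<Longrightarrow> \<bar>J z / (exp z * sqrt (2 * pi / z)) - (1 - 15 / (8 * z))\<bar> \<le> C / z\<^sup>2 + C / z ^ 3"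
    using laplace_arc_integral[OF \<phi>b] unfolding J_def by blast
  define D where "D = (\<lambda>n. 8 * (real n - 1 / 8) powr (5 / 4) * cubic_partition n / exp (z n))"
  define err where "err = (\<lambda>z. C / z\<^sup>2 + C / z ^ 3 + (96 * exp (- 2 * z) + 19 * z * exp (49 / 50 * z)) / (exp z * sqrt (2 * pi / z)))"
  have bound: "\<forall>\<^sub>F n in sequentially. \<bar>D n - (1 - 15 / (8 * z n))\<bar> \<le> err (z n)"
    using cubic_partition_vs_laplace[OF \<phi>_def] eventually_gt_at_top[of 0]
  proof eventually_elim
    case (elim n)
    define N where "N = real n - 1 / 8"
    have "real n \<ge> 1" using elim(2) by simp
    hence N: "N > 0" by (simp add: N_def)
    have z: "z n = pi * sqrt N" "z n > 0" using N by (auto simp: z_def N_def)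
    define Q where "Q = exp (z n) * sqrt (2 * pi / z n)"
    have Q: "Q > 0" using z(2) by (simp add: Q_def)
    have "\<bar>8 * sqrt 2 * N * cubic_partition n - J (z n)\<bar> \<le> 96 * exp (- 2 * z n) + 19 * z n * exp (49 / 50 * z n)"
      using elim(1) unfolding Let_def N_def[symmetric] z(1)[symmetric] J_def .
    hence "\<bar>8 * sqrt 2 * N * cubic_partition n - J (z n)\<bar> / Q \<le> (96 * exp (- 2 * z n) + 19 * z n * exp (49 / 50 * z n)) / Q"
      using Q by (intro divide_right_mono) auto
    also have "\<bar>8 * sqrt 2 * N * cubic_partition n - J (z n)\<bar> / Q = \<bar>8 * sqrt 2 * N * cubic_partition n / Q - J (z n) / Q\<bar>"
      using Q by (simp add: diff_divide_distrib[symmetric])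
    finally have 1: "\<bar>8 * sqrt 2 * N * cubic_partition n / Q - J (z n) / Q\<bar> \<le> (96 * exp (- 2 * z n) + 19 * z n * exp (49 / 50 * z n)) / Q" .
    have 2: "\<bar>J (z n) / Q - (1 - 15 / (8 * z n))\<bar> \<le> C / (z n)\<^sup>2 + C / z n ^ 3"
      unfolding Q_def by (rule C) fact
    have "sqrt (2 * pi / z n) = sqrt 2 / N powr (1 / 4)"
    proof -
      have "2 * pi / z n = 2 / N powr (1 / 2)" using N by (simp add: z powr_half_sqrt)
      also have "sqrt \<dots> = sqrt 2 / N powr (1 / 4)"
        using N by (simp add: real_sqrt_divide powr_half_sqrt[symmetric] powr_powr)
      finally show ?thesis .
    qed
    hence "8 * sqrt 2 * N * cubic_partition n / Q = 8 * (N * N powr (1 / 4)) * cubic_partition n / exp (z n)"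
      using N by (simp add: Q_def)
    also have "N * N powr (1 / 4) = N powr (5 / 4)"
      using N powr_add[of N 1 "1 / 4"] by simp
    finally have "8 * sqrt 2 * N * cubic_partition n / Q = D n" by (simp add: D_def N_def)
    with 1 have 1: "\<bar>D n - J (z n) / Q\<bar> \<le> (96 * exp (- 2 * z n) + 19 * z n * exp (49 / 50 * z n)) / Q"
      by simp
    have "\<bar>u - w\<bar> \<le> W + V" if "\<bar>u - v\<bar> \<le> V" "\<bar>v - w\<bar> \<le> W" for u v w V W :: real
      using that by linarith
    from this[OF 1 2] show ?case unfolding err_def Q_def[symmetric] .
  qed
  have zlim: "filterlim z at_top sequentially" unfolding z_def by real_asymp
  have "((\<lambda>z. z * err z) \<longlongrightarrow> 0) at_top" unfolding err_def by real_asymp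
  hence zerr: "(\<lambda>n. z n * err (z n)) \<longlonglongrightarrow> 0" by (rule filterlim_compose[OF _ zlim])
  have "(\<lambda>n. z n * (D n - (1 - 15 / (8 * z n)))) \<longlonglongrightarrow> 0"
  proof (rule Lim_null_comparison[OF _ zerr])
    show "\<forall>\<^sub>F n in sequentially. norm (z n * (D n - (1 - 15 / (8 * z n)))) \<le> z n * err (z n)"
      using bound eventually_compose_filterlim[OF eventually_gt_at_top[of 0] zlim]
      by eventually_elim (simp add: abs_mult)
  qed
  hence "(\<lambda>n. z n * (D n - (1 - 15 / (8 * z n))) - 15 / 8) \<longlonglongrightarrow> 0 - 15 / 8"
    by (intro tendsto_intros)
  moreover have "\<forall>\<^sub>F n in sequentially. z n * (D n - (1 - 15 / (8 * z n))) - 15 / 8 = z n * (D n - 1)"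
    using eventually_compose_filterlim[OF eventually_gt_at_top[of 0] zlim]
    by eventually_elim (simp add: field_simps)
  ultimately have 1: "(\<lambda>n. z n * (D n - 1)) \<longlonglongrightarrow> - 15 / 8"
    by (simp add: filterlim_cong)
  have 2: "(\<lambda>n. sqrt (real n) / z n) \<longlonglongrightarrow> inverse pi" unfolding z_def by real_asymp
  have "(\<lambda>n. (sqrt (real n) / z n) * (z n * (D n - 1))) \<longlonglongrightarrow> inverse pi * (- 15 / 8)"
    by (rule tendsto_mult[OF 2 1])
  moreover have "\<forall>\<^sub>F n in sequentially. (sqrt (real n) / z n) * (z n * (D n - 1)) = sqrt (real n) * (D n - 1)"
    using eventually_compose_filterlim[OF eventually_gt_at_top[of 0] zlim]
    by eventually_elim simp
  ultimately have "(\<lambda>n. sqrt (real n) * (D n - 1)) \<longlonglongrightarrow> inverse pi * (- 15 / 8)"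
    by (rule Lim_transform_eventually)
  thus ?thesis unfolding D_def by (simp add: field_simps)
qed

text \<open>
  The logarithm of the preceding expansion; replacing \<open>N = n - 1 / 8\<close> by \<open>n\<close> in the exponential
  contributes \<open>- \<pi> / 16\<close> to the coefficient of \<open>1 / sqrt n\<close>, and in the power only
  \<open>O(1 / n)\<close>.
\<close>

theorem corollary3p3:
  shows "(\<lambda>n. ln (cubic_partition n)
            - (pi * sqrt (real n) - 5 / 4 * ln (real n) - ln 8
               - (15 / (8 * pi) + pi / 16) * (1 / sqrt (real n))))
         \<in> o(\<lambda>n. 1 / sqrt (real n))"
proof -
  define D where "D = (\<lambda>n. 8 * (real n - 1 / 8) powr (5 / 4) * cubic_partition n / exp (pi * sqrt (real n - 1 / 8)))"
  have D: "(\<lambda>n. sqrt (real n) * (D n - 1)) \<longlonglongrightarrow> - 15 / (8 * pi)"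
    unfolding D_def by (rule cubic_partition_second_order)
  have "(\<lambda>n. 1 / sqrt (real n)) \<longlonglongrightarrow> 0" by real_asymp
  from tendsto_mult[OF this D] have "(\<lambda>n. 1 / sqrt (real n) * (sqrt (real n) * (D n - 1))) \<longlonglongrightarrow> 0" by simp
  moreover have "\<forall>\<^sub>F n in sequentially. 1 / sqrt (real n) * (sqrt (real n) * (D n - 1)) = D n - 1"
    using eventually_gt_at_top[of 0] by eventually_elim simp
  ultimately have D1: "(\<lambda>n. D n - 1) \<longlonglongrightarrow> 0" by (rule Lim_transform_eventually)
  have small: "\<forall>\<^sub>F n in sequentially. \<bar>D n - 1\<bar> < 1 / 2"
    using order_tendstoD(2)[OF tendsto_rabs_zero[OF D1], of "1 / 2"] by simp
  have lnD: "(\<lambda>n. sqrt (real n) * (ln (D n) - (D n - 1))) \<longlonglongrightarrow> 0"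
  proof (rule Lim_null_comparison)
    show "\<forall>\<^sub>F n in sequentially. norm (sqrt (real n) * (ln (D n) - (D n - 1))) \<le> 2 * \<bar>sqrt (real n) * (D n - 1)\<bar> * \<bar>D n - 1\<bar>"
      using small
    proof eventually_elim
      case (elim n)
      have "\<bar>ln (1 + (D n - 1)) - (D n - 1)\<bar> \<le> 2 * (D n - 1)\<^sup>2"
        by (rule abs_ln_one_plus_x_minus_x_bound) (use elim in simp)
      hence "sqrt (real n) * \<bar>ln (D n) - (D n - 1)\<bar> \<le> sqrt (real n) * (2 * (D n - 1)\<^sup>2)"
        by (intro mult_left_mono) auto
      thus ?case by (simp add: abs_mult power2_eq_square mult_ac)
    qed
    have "(\<lambda>n. 2 * \<bar>sqrt (real n) * (D n - 1)\<bar> * \<bar>D n - 1\<bar>) \<longlonglongrightarrow> 2 * \<bar>- 15 / (8 * pi)\<bar> * \<bar>0\<bar>"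
      by (intro tendsto_intros D D1)
    thus "(\<lambda>n. 2 * \<bar>sqrt (real n) * (D n - 1)\<bar> * \<bar>D n - 1\<bar>) \<longlonglongrightarrow> 0" by simp
  qed
  define E where "E = (\<lambda>n::nat. sqrt (real n) * (pi * sqrt (real n - 1 / 8) - pi * sqrt (real n) + pi / 16 * (1 / sqrt (real n))
       - 5 / 4 * (ln (real n - 1 / 8) - ln (real n))))"
  have E: "E \<longlonglongrightarrow> 0" unfolding E_def by real_asymp
  define f where "f = (\<lambda>n. ln (cubic_partition n)
            - (pi * sqrt (real n) - 5 / 4 * ln (real n) - ln 8
               - (15 / (8 * pi) + pi / 16) * (1 / sqrt (real n))))"
  have "(\<lambda>n. E n + sqrt (real n) * (ln (D n) - (D n - 1)) + (sqrt (real n) * (D n - 1) + 15 / (8 * pi))) \<longlonglongrightarrow>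
       0 + 0 + (- 15 / (8 * pi) + 15 / (8 * pi))"
    by (intro tendsto_intros E lnD D)
  moreover have "\<forall>\<^sub>F n in sequentially. E n + sqrt (real n) * (ln (D n) - (D n - 1)) + (sqrt (real n) * (D n - 1) + 15 / (8 * pi))
       = f n / (1 / sqrt (real n))"
    using small eventually_gt_at_top[of 0]
  proof eventually_elim
    case (elim n)
    have n: "real n \<ge> 1" using elim(2) by simp
    define N where "N = real n - 1 / 8"
    have N: "N > 0" using n by (simp add: N_def)
    have "D n > 0" using elim(1) by (simp add: abs_if split: if_splits)
    hence a: "cubic_partition n > 0" unfolding D_def N_def[symmetric] using N
      by (simp add: zero_less_divide_iff zero_less_mult_iff)
    have "ln (D n) = ln 8 + 5 / 4 * ln N + ln (cubic_partition n) - pi * sqrt N"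
      unfolding D_def N_def[symmetric] using N a by (simp add: ln_div ln_mult ln_powr)
    hence "ln (cubic_partition n) = ln (D n) - ln 8 - 5 / 4 * ln N + pi * sqrt N" by simp
    hence feq: "f n = pi * sqrt N - pi * sqrt (real n) - 5 / 4 * (ln N - ln (real n)) + ln (D n)
         + (15 / (8 * pi) + pi / 16) * (1 / sqrt (real n))"
      by (simp add: f_def algebra_simps diff_divide_distrib)
    have gen: "s * (p - q + b * c - r) + s * (l - d) + (s * d + a) = (p - q - r + l + (a + b) * c) * s"
      if "s * c = 1" for s p q b c r l d a :: real
    proof -
      have "a * (s * c) = a" using that by simp
      thus ?thesis by (simp add: algebra_simps)
    qed
    have "sqrt (real n) * (1 / sqrt (real n)) = 1" using n by simp
    from gen[OF this] have "E n + sqrt (real n) * (ln (D n) - (D n - 1)) + (sqrt (real n) * (D n - 1) + 15 / (8 * pi))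
       = f n * sqrt (real n)"
      unfolding E_def feq N_def[symmetric] .
    thus ?case by simp
  qed
  ultimately have "(\<lambda>n. f n / (1 / sqrt (real n))) \<longlonglongrightarrow> 0 + 0 + (- 15 / (8 * pi) + 15 / (8 * pi))"
    by (rule Lim_transform_eventually)
  hence "(\<lambda>n. f n / (1 / sqrt (real n))) \<longlonglongrightarrow> 0" by simp
  hence "f \<in> o(\<lambda>n. 1 / sqrt (real n))"
    by (rule smalloI_tendsto) (use eventually_gt_at_top[of 0] in \<open>auto elim!: eventually_mono\<close>)
  thus ?thesis unfolding f_def .
qed

end
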